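(* For every returning (non-centralized) parallel communicating pushdown automata system $\mathcal{A}$ there exists a returning parallel communicating pushdown automata system $\mathcal{A}'$ that satisfies the known communication property and accepts the same language as $\mathcal{A}$, i.e. $L_r(\mathcal{A}')=L_r(\mathcal{A})$.
   Context: A parallel communicating pushdown automata system (PCPA) of degree $n\ge 1$ is $\mathcal{A}=(V,\Delta,A_1,\dots,A_n,K)$, where $V$ is the input alphabet, $\Delta$ the pushdown alphabet, each component $A_i=(Q_i,V,\Delta,f_i,q_i,Z_i,F_i)$ is a pushdown automaton with finite state set $Q_i$, initial state $q_i$, initial stack symbol $Z_i\in\Delta$, final states $F_i\subseteq Q_i$, and transition map $f_i$ from $Q_i\times(V\cup\{\epsilon\})\times\Delta$ to finite subsets of $Q_i\times\Delta^*$; $K\subseteq\{K_1,\dots,K_n\}\subseteq\Delta$ is the set of query symbols ($K_j$ queries component $j$); any component may introduce query symbols. A configuration is $(s_1,x_1,\alpha_1,\dots,s_n,x_n,\alpha_n)$ (state, unread input, stack content with top first, per component); the initial configuration on input $x$ is $(q_1,x,Z_1,\dots,q_n,x,Z_n)$. One step in returning mode, from $(s_1,x_1,B_1\alpha_1,\dots,s_n,x_n,B_n\alpha_n)$ with $B_i\in\Delta$: (i) if no top symbol $B_i$ is a query symbol, every component $i$ simultaneously performs a transition $x_i=a_iy_i$, $a_i\in V\cup\{\epsilon\}$, $(p_i,\beta_i')\in f_i(s_i,a_i,B_i)$, new stack $\beta_i'\alpha_i$; (ii) otherwise (communication step) for every $i$ with $B_i=K_{j}$ and $B_{j}\notin K$,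 the stack of $i$ becomes $B_j\alpha_j\alpha_i$ and the stack of $j$ becomes $Z_j$; all other stacks, all states and all inputs are unchanged. The returning language $L_r(\mathcal{A})$ is the set of $x\in V^*$ such that from the initial configuration one reaches a configuration in which every component has read all of $x$ and is in a final state. A returning PCPA (RPCPA) is a PCPA working in returning mode. Known communication property: the state set of each component $i$ has the form $Q_i\times\{0,1\}$, and whenever component $j$ sends its stack contents to a querying component in a communication step (both in states with second coordinate $0$), then at the next ordinary transition the state of component $j$ has second coordinate $1$; and component $j$ never reaches a state with second coordinate $1$ in any other case. *)

theory Defs
  imports Main
begin

text \<open>A pushdown automaton component A_i = (Q_i, V, Delta, f_i, q_i, Z_i, F_i).
  The empty input (epsilon) is encoded as None.\<close>
record ('q, 'a, 'g) pda =
  pstates :: "'q set"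
  ptrans  :: "'q \<Rightarrow> 'a option \<Rightarrow> 'g \<Rightarrow> ('q \<times> 'g list) set"
  pinit   :: 'q
  pbottom :: 'g
  pfinal  :: "'q set"

text \<open>A PCPA system (V, Delta, A_1, ..., A_n, K). Components are indexed by 1..n.
  qsym j is the symbol K_j; qidx is the set of indices j such that K_j belongs to K.\<close>
record ('q, 'a, 'g) pcpa =
  deg   :: nat
  alph  :: "'a set"
  stalph :: "'g set"
  comp  :: "nat \<Rightarrow> ('q, 'a, 'g) pda"
  qsym  :: "nat \<Rightarrow> 'g"
  qidx  :: "nat set"

definition wf_pcpa :: "('q, 'a, 'g) pcpa \<Rightarrow> bool" where
  "wf_pcpa A \<longleftrightarrow>
     deg A \<ge> 1 \<and> finite (alph A) \<and> finite (stalph A) \<and>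
     inj_on (qsym A) {1..deg A} \<and> qsym A ` {1..deg A} \<subseteq> stalph A \<and>
     qidx A \<subseteq> {1..deg A} \<and>
     (\<forall>i\<in>{1..deg A}.
        finite (pstates (comp A i)) \<and>
        pinit (comp A i) \<in> pstates (comp A i) \<and>
        pbottom (comp A i) \<in> stalph A \<and>
        pfinal (comp A i) \<subseteq> pstates (comp A i) \<and>
        (\<forall>q a B. finite (ptrans (comp A i) q a B) \<and>
           ptrans (comp A i) q a B \<subseteq> pstates (comp A i) \<times> lists (stalph A) \<and>
           ((q \<notin> pstates (comp A i) \<or> B \<notin> stalph A \<or>
             (\<exists>b. a = Some b \<and> b \<notin> alph A)) \<longrightarrow> ptrans (comp A i) q a B = {})))"

text \<open>Configurations: for each component index, (state, unread input, stack with top first).\<close>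
type_synonym ('q, 'a, 'g) conf = "nat \<Rightarrow> 'q \<times> 'a list \<times> 'g list"

definition cstate :: "('q, 'a, 'g) conf \<Rightarrow> nat \<Rightarrow> 'q" where
  "cstate c i = fst (c i)"
definition cinput :: "('q, 'a, 'g) conf \<Rightarrow> nat \<Rightarrow> 'a list" where
  "cinput c i = fst (snd (c i))"
definition cstack :: "('q, 'a, 'g) conf \<Rightarrow> nat \<Rightarrow> 'g list" where
  "cstack c i = snd (snd (c i))"

definition init_conf :: "('q, 'a, 'g) pcpa \<Rightarrow> 'a list \<Rightarrow> ('q, 'a, 'g) conf" where
  "init_conf A x = (\<lambda>i. (pinit (comp A i), x, [pbottom (comp A i)]))"

definition is_query :: "('q, 'a, 'g) pcpa \<Rightarrow> 'g \<Rightarrow> bool" where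
  "is_query A B \<longleftrightarrow> (\<exists>j\<in>qidx A. B = qsym A j)"

definition answers :: "('q, 'a, 'g) pcpa \<Rightarrow> ('q, 'a, 'g) conf \<Rightarrow> nat \<Rightarrow> nat \<Rightarrow> bool" where
  "answers A c i j \<longleftrightarrow> j \<in> qidx A \<and> hd (cstack c i) = qsym A j \<and>
      \<not> is_query A (hd (cstack c j))"

definition all_nonempty :: "('q, 'a, 'g) pcpa \<Rightarrow> ('q, 'a, 'g) conf \<Rightarrow> bool" where
  "all_nonempty A c \<longleftrightarrow> (\<forall>i\<in>{1..deg A}. cstack c i \<noteq> [])"

definition ordinary_conf :: "('q, 'a, 'g) pcpa \<Rightarrow> ('q, 'a, 'g) conf \<Rightarrow> bool" where
  "ordinary_conf A c \<longleftrightarrow> all_nonempty A c \<and>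
      (\<forall>i\<in>{1..deg A}. \<not> is_query A (hd (cstack c i)))"

definition comm_conf :: "('q, 'a, 'g) pcpa \<Rightarrow> ('q, 'a, 'g) conf \<Rightarrow> bool" where
  "comm_conf A c \<longleftrightarrow> all_nonempty A c \<and>
      (\<exists>i\<in>{1..deg A}. is_query A (hd (cstack c i)))"

definition ord_step :: "('q, 'a, 'g) pcpa \<Rightarrow> ('q, 'a, 'g) conf \<Rightarrow> ('q, 'a, 'g) conf \<Rightarrow> bool" where
  "ord_step A c c' \<longleftrightarrow> ordinary_conf A c \<and>
     (\<forall>i. i \<notin> {1..deg A} \<longrightarrow> c' i = c i) \<and>
     (\<forall>i\<in>{1..deg A}. \<exists>a y p \<beta>.
        (case a of None \<Rightarrow> cinput c i = y | Some b \<Rightarrow> cinput c i = b # y) \<and>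
        (p, \<beta>) \<in> ptrans (comp A i) (cstate c i) a (hd (cstack c i)) \<and>
        c' i = (p, y, \<beta> @ tl (cstack c i)))"

definition comm_step :: "('q, 'a, 'g) pcpa \<Rightarrow> ('q, 'a, 'g) conf \<Rightarrow> ('q, 'a, 'g) conf \<Rightarrow> bool" where
  "comm_step A c c' \<longleftrightarrow> comm_conf A c \<and>
     (\<forall>i. i \<notin> {1..deg A} \<longrightarrow> c' i = c i) \<and>
     (\<forall>i\<in>{1..deg A}.
        cstate c' i = cstate c i \<and> cinput c' i = cinput c i \<and>
        (\<forall>j\<in>{1..deg A}. answers A c i j \<longrightarrow>
             cstack c' i = cstack c j @ tl (cstack c i)) \<and>
        ((\<exists>k\<in>{1..deg A}. answers A c k i) \<longrightarrow> cstack c' i = [pbottom (comp A i)]) \<and>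
        ((\<not> (\<exists>j\<in>{1..deg A}. answers A c i j) \<and> \<not> (\<exists>k\<in>{1..deg A}. answers A c k i))
             \<longrightarrow> cstack c' i = cstack c i))"

definition rstep :: "('q, 'a, 'g) pcpa \<Rightarrow> ('q, 'a, 'g) conf \<Rightarrow> ('q, 'a, 'g) conf \<Rightarrow> bool" where
  "rstep A c c' \<longleftrightarrow> ord_step A c c' \<or> comm_step A c c'"

definition lang_r :: "('q, 'a, 'g) pcpa \<Rightarrow> 'a list set" where
  "lang_r A = {x. set x \<subseteq> alph A \<and>
      (\<exists>c. (rstep A)\<^sup>*\<^sup>* (init_conf A x) c \<and>
           (\<forall>i\<in>{1..deg A}. cinput c i = [] \<and> cstate c i \<in> pfinal (comp A i)))}"

definition sends :: "('q \<times> bool, 'a, 'g) pcpa \<Rightarrow> ('q \<times> bool, 'a, 'g) conf \<Rightarrow> nat \<Rightarrow> bool" where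
  "sends A c j \<longleftrightarrow> comm_conf A c \<and>
     (\<exists>i\<in>{1..deg A}. answers A c i j \<and> \<not> snd (cstate c i) \<and> \<not> snd (cstate c j))"

definition comm_property :: "('q \<times> bool, 'a, 'g) pcpa \<Rightarrow> bool" where
  "comm_property A \<longleftrightarrow>
     (\<forall>i\<in>{1..deg A}. \<exists>Q. pstates (comp A i) = Q \<times> UNIV) \<and>
     (\<forall>j\<in>{1..deg A}. \<not> snd (pinit (comp A j))) \<and>
     (\<forall>x cs m. set x \<subseteq> alph A \<longrightarrow> cs 0 = init_conf A x \<longrightarrow>
        (\<forall>t<m. rstep A (cs t) (cs (Suc t))) \<longrightarrow>
        (\<forall>k<m. ordinary_conf A (cs k) \<longrightarrow>
           (\<forall>j\<in>{1..deg A}.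
              (snd (cstate (cs (Suc k)) j) \<longleftrightarrow>
               (\<exists>l<k. sends A (cs l) j \<and> (\<forall>t. l \<le> t \<and> t < k \<longrightarrow> comm_conf A (cs t)))))))"

end

(*
A component cannot see whether its stack has just been sent away: the symbol left behind may be
a query symbol, and it may be sent on or replaced before the next ordinary step.  Therefore every
step is announced beforehand.  An additional component guesses the relation R of all pairs (i, j)
such that the top symbol of component i is the query symbol of component j, and all the others
fetch R by querying it.  Each of them compares R with its own top symbol and blocks on a mismatch.
If R is empty, they carry out an ordinary step of A.  Otherwise the components whose query is
answered put a genuine query symbol on top, and exactly one communication step of A takes place;
R tells every component whether it was a sender, which determines its next bit.  The symbols of A
themselves are no longer query symbols, so no communication happens unannounced.
*)

theory Submission
  imports Defs
begin

section \<open>Steps and renamings\<close>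

text \<open>A communication step moves stacks but leaves states alone. Hence \<open>R\<close> is
  popped into the state as soon as it arrives: there it survives the loss of the stack and can still
  determine the bit after the communication. A component that is queried need not send, because it
  may be querying itself. This is why \<open>R\<close> lists all pairs and not only the queried
  components. No component can verify \<open>R\<close> as a whole, but component \<open>i\<close>
  can verify row \<open>i\<close>, and the rows together determine \<open>R\<close>. The additional
  component sends its own stack whenever \<open>R\<close> is fetched, so it owes a bit as well; it
  shows it in \<open>MAct\<close>. It must also exhaust its input before acceptance, which it does
  during the simulated ordinary steps. If all queried components query themselves, nobody is
  answered and the communication step of \<open>A\<close> changes nothing; it is simulated by doing
  nothing. More generally, a query that is not answered stays on its stack as an inert symbol until
  a later round. The theorem prescribes the types of states and stack symbols, so the finite sets of
  names are finally injected into the natural numbers.\<close>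

definition well_formed_conf :: "('q, 'a, 'g) pcpa \<Rightarrow> ('q, 'a, 'g) conf \<Rightarrow> bool" where
  "well_formed_conf A c \<longleftrightarrow>
     (\<forall>i\<in>{1..deg A}. cstate c i \<in> pstates (comp A i) \<and> set (cstack c i) \<subseteq> stalph A)"

lemma answers_imp_query: "answers A c i j \<Longrightarrow> is_query A (hd (cstack c i))"
  unfolding answers_def is_query_def by blast

lemma answers_unique:
  assumes "wf_pcpa A" "answers A c i j" "answers A c i k"
  shows "j = k"
proof -
  have "inj_on (qsym A) {1..deg A}" "qidx A \<subseteq> {1..deg A}"
    using assms(1) unfolding wf_pcpa_def by simp_all
  moreover have "j \<in> qidx A" "k \<in> qidx A" "qsym A j = qsym A k"
    using assms(2,3) unfolding answers_def by simp_all
  ultimately show ?thesis by (meson inj_onD subsetD)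
qed

lemma answers_deg: "wf_pcpa A \<Longrightarrow> answers A c i j \<Longrightarrow> j \<in> {1..deg A}"
  unfolding wf_pcpa_def answers_def by (simp add: subset_iff)

lemma not_ordinary_comm: "comm_conf A c \<Longrightarrow> \<not> ordinary_conf A c"
  unfolding comm_conf_def ordinary_conf_def by blast

lemma rstep_ordinary: "ordinary_conf A c \<Longrightarrow> rstep A c d \<longleftrightarrow> ord_step A c d"
  unfolding rstep_def comm_step_def using not_ordinary_comm by blast

lemma rstep_comm: "comm_conf A c \<Longrightarrow> rstep A c d \<longleftrightarrow> comm_step A c d"
  unfolding rstep_def ord_step_def using not_ordinary_comm by blast

section \<open>Communication steps are deterministic\<close>

text \<open>\<open>THE\<close> is legitimate because query symbols of different components differ.
  Testing "asks" before "is asked" loses nothing: a component that answers has no query symbol on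
  top and so does not ask.\<close>

definition comm_succ :: "('q, 'a, 'g) pcpa \<Rightarrow> ('q, 'a, 'g) conf \<Rightarrow> ('q, 'a, 'g) conf" where
  "comm_succ A c i =
     (if i \<in> {1..deg A} then
        (cstate c i, cinput c i,
         if \<exists>j. answers A c i j then cstack c (THE j. answers A c i j) @ tl (cstack c i)
         else if \<exists>k\<in>{1..deg A}. answers A c k i then [pbottom (comp A i)]
         else cstack c i)
      else c i)"

lemma comm_succ_stack:
  assumes "wf_pcpa A" "i \<in> {1..deg A}" "answers A c i j"
  shows "comm_succ A c i = (cstate c i, cinput c i, cstack c j @ tl (cstack c i))"
proof -
  have "(THE j. answers A c i j) = j"
    using assms answers_unique by (intro the_equality) blast+
  then show ?thesis using assms(2,3) unfolding comm_succ_def by auto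
qed

lemma comm_step_iff:
  assumes "wf_pcpa A"
  shows "comm_step A c d \<longleftrightarrow> comm_conf A c \<and> d = comm_succ A c"
proof
  assume s: "comm_step A c d"
  have "d i = comm_succ A c i" for i
  proof (cases "i \<in> {1..deg A}")
    case False
    then show ?thesis using s unfolding comm_step_def comm_succ_def by auto
  next
    case i: True
    have eq: "d i = (cstate d i, cinput d i, cstack d i)"
      unfolding cstate_def cinput_def cstack_def by simp
    show ?thesis
    proof (cases "\<exists>j. answers A c i j")
      case True
      then obtain j where j: "answers A c i j" by blast
      then have "cstack d i = cstack c j @ tl (cstack c i)"
        using s i answers_deg[OF assms j] unfolding comm_step_def by blast
      then show ?thesis using eq s i comm_succ_stack[OF assms i j] unfolding comm_step_def by auto
    next
      case no: False
      then show ?thesis using eq s i unfolding comm_step_def comm_succ_def by auto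
    qed
  qed
  then show "comm_conf A c \<and> d = comm_succ A c" using s unfolding comm_step_def by auto
next
  assume s: "comm_conf A c \<and> d = comm_succ A c"
  have "cstate d i = cstate c i \<and> cinput d i = cinput c i" if "i \<in> {1..deg A}" for i
    using s that unfolding cstate_def cinput_def comm_succ_def by auto
  moreover have "cstack d i = cstack c j @ tl (cstack c i)"
    if "i \<in> {1..deg A}" "answers A c i j" for i j
    using comm_succ_stack[OF assms that] s unfolding cstack_def by auto
  moreover have "cstack d i = [pbottom (comp A i)]"
    if "i \<in> {1..deg A}" "k \<in> {1..deg A}" "answers A c k i" for i k
  proof -
    have "\<not> is_query A (hd (cstack c i))" using that(3) unfolding answers_def by blast
    then have "\<nexists>j. answers A c i j" using answers_imp_query by blast
    then show ?thesis using that s unfolding comm_succ_def cstack_def by auto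
  qed
  moreover have "cstack d i = cstack c i"
    if "i \<in> {1..deg A}" "\<not> (\<exists>j\<in>{1..deg A}. answers A c i j)"
      "\<not> (\<exists>k\<in>{1..deg A}. answers A c k i)" for i
    using that s answers_deg[OF assms] unfolding comm_succ_def cstack_def by auto
  moreover have "d i = c i" if "i \<notin> {1..deg A}" for i
    using that s unfolding comm_succ_def by auto
  ultimately show "comm_step A c d" using s unfolding comm_step_def by blast
qed

section \<open>States and stacks stay within the declared finite sets\<close>

lemma well_formed_init:
  assumes "wf_pcpa A"
  shows "well_formed_conf A (init_conf A x)"
  using assms unfolding wf_pcpa_def well_formed_conf_def init_conf_def cstate_def cstack_def
  by auto

lemma set_tl_subset: "set (tl xs) \<subseteq> set xs"
  by (cases xs) auto

lemma well_formed_ord_step: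
  assumes wf: "wf_pcpa A" and c: "well_formed_conf A c" and "ord_step A c d"
  shows "well_formed_conf A d"
  unfolding well_formed_conf_def
proof (intro ballI)
  fix i assume i: "i \<in> {1..deg A}"
  then obtain a y p \<beta> where
    t: "(p, \<beta>) \<in> ptrans (comp A i) (cstate c i) a (hd (cstack c i))"
    and d: "d i = (p, y, \<beta> @ tl (cstack c i))"
    using assms(3) unfolding ord_step_def by blast
  have "p \<in> pstates (comp A i) \<and> \<beta> \<in> lists (stalph A)"
    using wf i t unfolding wf_pcpa_def by blast
  moreover have "set (tl (cstack c i)) \<subseteq> stalph A"
    using c i set_tl_subset unfolding well_formed_conf_def by fast
  ultimately show "cstate d i \<in> pstates (comp A i) \<and> set (cstack d i) \<subseteq> stalph A"
    unfolding cstate_def cstack_def d by auto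
qed

lemma well_formed_comm_step:
  assumes wf: "wf_pcpa A" and c: "well_formed_conf A c" and "comm_step A c d"
  shows "well_formed_conf A d"
  unfolding well_formed_conf_def
proof (intro ballI)
  fix i assume i: "i \<in> {1..deg A}"
  have d: "d = comm_succ A c" using assms(3) comm_step_iff[OF wf] by blast
  have tl: "set (tl (cstack c i)) \<subseteq> stalph A"
    using c i set_tl_subset unfolding well_formed_conf_def by fast
  show "cstate d i \<in> pstates (comp A i) \<and> set (cstack d i) \<subseteq> stalph A"
  proof (cases "\<exists>j. answers A c i j")
    case True
    then obtain j where j: "answers A c i j" by blast
    have "set (cstack c j) \<subseteq> stalph A"
      using c answers_deg[OF wf j] unfolding well_formed_conf_def by blast
    then show ?thesis
      using tl c i unfolding cstate_def cstack_def d comm_succ_stack[OF wf i j] well_formed_conf_def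
      by auto
  next
    case False
    have "pbottom (comp A i) \<in> stalph A" using wf i unfolding wf_pcpa_def by blast
    then show ?thesis
      using c i False unfolding d comm_succ_def well_formed_conf_def
      by (auto simp: cstate_def cstack_def)
  qed
qed

lemma well_formed_rstep:
  assumes "wf_pcpa A" "well_formed_conf A c" "rstep A c d"
  shows "well_formed_conf A d"
  using assms well_formed_ord_step well_formed_comm_step unfolding rstep_def by blast

text \<open>Serves two purposes: a renaming is injective only on the declared stack alphabet, and
  the transitions of the coordinated system demand states and stack symbols of
  \<open>A\<close>.\<close>

lemma well_formed_reachable:
  assumes "wf_pcpa A" "(rstep A)\<^sup>*\<^sup>* (init_conf A x) c"
  shows "well_formed_conf A c"
  using assms(2)
  by induction (auto intro: well_formed_init well_formed_rstep assms(1))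

lemma well_formed_hd:
  "well_formed_conf A c \<Longrightarrow> all_nonempty A c \<Longrightarrow> i \<in> {1..deg A} \<Longrightarrow> hd (cstack c i) \<in> stalph A"
  unfolding well_formed_conf_def all_nonempty_def by (metis hd_in_set subset_code(1))

section \<open>Renamings of states and stack symbols, and their effect on runs\<close>

definition map_conf :: "('q \<Rightarrow> 'r) \<Rightarrow> ('g \<Rightarrow> 'h) \<Rightarrow> ('q, 'a, 'g) conf \<Rightarrow> ('r, 'a, 'h) conf" where
  "map_conf f h c = (\<lambda>i. (f (cstate c i), cinput c i, map h (cstack c i)))"

lemma map_conf_sel [simp]:
  "cstate (map_conf f h c) i = f (cstate c i)"
  "cinput (map_conf f h c) i = cinput c i"
  "cstack (map_conf f h c) i = map h (cstack c i)"
  unfolding map_conf_def cstate_def cinput_def cstack_def by auto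

text \<open>Transitions and final states are only carried forward; equality of languages comes from
  a second renaming in the opposite direction. Injectivity of \<open>h\<close> ensures that no query
  symbol is created or lost. The initial data are related at every index because
  \<open>init_conf\<close> is a total function of the index.\<close>

definition renaming ::
  "('q \<Rightarrow> 'r) \<Rightarrow> ('g \<Rightarrow> 'h) \<Rightarrow> ('q, 'a, 'g) pcpa \<Rightarrow> ('r, 'a, 'h) pcpa \<Rightarrow> bool" where
  "renaming f h A B \<longleftrightarrow>
     deg B = deg A \<and> alph B = alph A \<and> qidx B = qidx A \<and> inj_on h (stalph A) \<and>
     (\<forall>j\<in>{1..deg A}. qsym B j = h (qsym A j)) \<and>
     (\<forall>i. pinit (comp B i) = f (pinit (comp A i)) \<and> pbottom (comp B i) = h (pbottom (comp A i))) \<and>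
     (\<forall>i\<in>{1..deg A}. (\<forall>q\<in>pfinal (comp A i). f q \<in> pfinal (comp B i)) \<and>
        (\<forall>q a X p \<beta>. (p, \<beta>) \<in> ptrans (comp A i) q a X \<longrightarrow>
           (f p, map h \<beta>) \<in> ptrans (comp B i) (f q) a (h X)))"

context
  fixes f h and A :: "('q, 'a, 'g) pcpa" and B :: "('r, 'a, 'h) pcpa"
  assumes ren: "renaming f h A B" and wf: "wf_pcpa A" and wf': "wf_pcpa B"
begin

lemma renaming_deg: "deg B = deg A"
  using ren unfolding renaming_def by blast

lemma renaming_init: "init_conf B x = map_conf f h (init_conf A x)"
  using ren unfolding renaming_def map_conf_def init_conf_def cstate_def cinput_def cstack_def
  by auto

lemma renaming_query_eq:
  assumes "X \<in> stalph A" "j \<in> qidx A"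
  shows "h X = qsym B j \<longleftrightarrow> X = qsym A j"
proof -
  have "j \<in> {1..deg A}" "qsym A j \<in> stalph A" using wf assms(2) unfolding wf_pcpa_def by auto
  then show ?thesis using ren assms(1) unfolding renaming_def by (auto dest: inj_onD)
qed

lemma renaming_is_query: "X \<in> stalph A \<Longrightarrow> is_query B (h X) \<longleftrightarrow> is_query A X"
  using ren renaming_query_eq unfolding is_query_def renaming_def by auto

lemma renaming_all_nonempty: "all_nonempty B (map_conf f h c) \<longleftrightarrow> all_nonempty A c"
  unfolding all_nonempty_def by (simp add: renaming_deg)

context
  fixes c
  assumes c: "well_formed_conf A c"
begin

lemma renaming_ordinary: "ordinary_conf B (map_conf f h c) \<longleftrightarrow> ordinary_conf A c"
proof -
  have "(\<forall>i\<in>{1..deg A}. \<not> is_query B (hd (map h (cstack c i)))) \<longleftrightarrow>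
        (\<forall>i\<in>{1..deg A}. \<not> is_query A (hd (cstack c i)))" if "all_nonempty A c"
    using that well_formed_hd[OF c] renaming_is_query unfolding all_nonempty_def
    by (simp add: list.map_sel(1) Ball_def)
  then show ?thesis
    unfolding ordinary_conf_def renaming_all_nonempty renaming_deg map_conf_sel by blast
qed

lemma renaming_comm: "comm_conf B (map_conf f h c) \<longleftrightarrow> comm_conf A c"
  using renaming_ordinary renaming_all_nonempty
  unfolding ordinary_conf_def comm_conf_def by blast

lemma renaming_answers:
  assumes "all_nonempty A c" "i \<in> {1..deg A}"
  shows "answers B (map_conf f h c) i j \<longleftrightarrow> answers A c i j"
proof (cases "j \<in> qidx A")
  case True
  then have j: "j \<in> {1..deg A}" using wf unfolding wf_pcpa_def by blast
  have ne: "cstack c i \<noteq> []" "cstack c j \<noteq> []"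
    using assms j unfolding all_nonempty_def by blast+
  show ?thesis
    using ne True renaming_query_eq[OF well_formed_hd[OF c assms] True]
      renaming_is_query[OF well_formed_hd[OF c assms(1) j]] ren
    unfolding answers_def renaming_def by (simp add: list.map_sel(1))
next
  case False
  then show ?thesis using ren unfolding answers_def renaming_def by blast
qed

lemma renaming_ord_step:
  assumes "ord_step A c d"
  shows "ord_step B (map_conf f h c) (map_conf f h d)"
proof -
  have o: "ordinary_conf A c" using assms unfolding ord_step_def by blast
  have "\<exists>a y p \<beta>. (case a of None \<Rightarrow> cinput c i = y | Some b \<Rightarrow> cinput c i = b # y) \<and>
        (p, \<beta>) \<in> ptrans (comp B i) (f (cstate c i)) a (hd (map h (cstack c i))) \<and>
        map_conf f h d i = (p, y, \<beta> @ tl (map h (cstack c i)))" if i: "i \<in> {1..deg A}" for i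
  proof -
    obtain a y p \<beta> where a: "case a of None \<Rightarrow> cinput c i = y | Some b \<Rightarrow> cinput c i = b # y"
      and t: "(p, \<beta>) \<in> ptrans (comp A i) (cstate c i) a (hd (cstack c i))"
      and d: "d i = (p, y, \<beta> @ tl (cstack c i))"
      using assms i unfolding ord_step_def by blast
    have "(f p, map h \<beta>) \<in> ptrans (comp B i) (f (cstate c i)) a (h (hd (cstack c i)))"
      using t i ren unfolding renaming_def by blast
    moreover have "cstack c i \<noteq> []" using o i unfolding ordinary_conf_def all_nonempty_def by blast
    ultimately show ?thesis
      using a d
      by (intro exI[of _ a] exI[of _ y] exI[of _ "f p"] exI[of _ "map h \<beta>"])
        (simp add: map_conf_def cstate_def cinput_def cstack_def list.map_sel(1) map_tl)
  qed
  moreover have "map_conf f h d i = map_conf f h c i" if "i \<notin> {1..deg A}" for i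
    using assms that unfolding ord_step_def map_conf_def cstate_def cinput_def cstack_def by auto
  ultimately show ?thesis
    unfolding ord_step_def renaming_deg map_conf_sel renaming_ordinary using o by blast
qed

lemma renaming_comm_succ:
  assumes "comm_conf A c"
  shows "comm_succ B (map_conf f h c) = map_conf f h (comm_succ A c)"
proof
  fix i
  have ne: "all_nonempty A c" using assms unfolding comm_conf_def by blast
  have eq: "answers B (map_conf f h c) i j \<longleftrightarrow> answers A c i j" if "i \<in> {1..deg A}" for i j
    using renaming_answers[OF ne that] .
  have Z: "pbottom (comp B i) = h (pbottom (comp A i))" using ren unfolding renaming_def by blast
  have ex: "(\<exists>k\<in>{1..deg A}. answers B (map_conf f h c) k i) \<longleftrightarrow> (\<exists>k\<in>{1..deg A}. answers A c k i)"
    using eq by blast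
  show "comm_succ B (map_conf f h c) i = map_conf f h (comm_succ A c) i"
  proof (cases "i \<in> {1..deg A}")
    case i: True
    have "cstate (comm_succ A c) i = cstate c i" "cinput (comm_succ A c) i = cinput c i"
      "cstack (comm_succ A c) i =
        (if \<exists>j. answers A c i j then cstack c (THE j. answers A c i j) @ tl (cstack c i)
         else if \<exists>k\<in>{1..deg A}. answers A c k i then [pbottom (comp A i)] else cstack c i)"
      using i unfolding comm_succ_def cstate_def cinput_def cstack_def by auto
    then have "map_conf f h (comm_succ A c) i = (f (cstate c i), cinput c i, map h
        (if \<exists>j. answers A c i j then cstack c (THE j. answers A c i j) @ tl (cstack c i)
         else if \<exists>k\<in>{1..deg A}. answers A c k i then [pbottom (comp A i)] else cstack c i))"
      unfolding map_conf_def by simp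
    then show ?thesis
      using i unfolding comm_succ_def[of B] renaming_deg ex map_conf_sel Z eq[OF i]
      by (simp only: if_True map_append map_tl list.map if_distrib[of "map h"])
  next
    case False
    then have "comm_succ A c i = c i" unfolding comm_succ_def by (rule if_not_P)
    then have "map_conf f h (comm_succ A c) i = map_conf f h c i"
      unfolding map_conf_def cstate_def cinput_def cstack_def by simp
    moreover have "comm_succ B (map_conf f h c) i = map_conf f h c i"
      using False unfolding comm_succ_def renaming_deg by (rule if_not_P)
    ultimately show ?thesis by simp
  qed
qed

lemma renaming_rstep: "rstep A c d \<Longrightarrow> rstep B (map_conf f h c) (map_conf f h d)"
  unfolding rstep_def comm_step_iff[OF wf] comm_step_iff[OF wf']
  using renaming_ord_step[of d] renaming_comm_succ renaming_comm by auto

end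

lemma renaming_lang: "lang_r A \<subseteq> lang_r B"
proof
  fix x assume "x \<in> lang_r A"
  then obtain c where x: "set x \<subseteq> alph A" and r: "(rstep A)\<^sup>*\<^sup>* (init_conf A x) c"
    and fin: "\<forall>i\<in>{1..deg A}. cinput c i = [] \<and> cstate c i \<in> pfinal (comp A i)"
    unfolding lang_r_def by blast
  from r have "(rstep B)\<^sup>*\<^sup>* (init_conf B x) (map_conf f h c)"
  proof induction
    case base
    show ?case by (simp add: renaming_init)
  next
    case (step c d)
    then show ?case
      using renaming_rstep[OF well_formed_reachable[OF wf step(1)] step(2)] by simp
  qed
  moreover have "\<forall>i\<in>{1..deg B}. cinput (map_conf f h c) i = [] \<and>
      cstate (map_conf f h c) i \<in> pfinal (comp B i)"
    using fin ren unfolding renaming_def by auto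
  moreover have "set x \<subseteq> alph B" using x ren unfolding renaming_def by simp
  ultimately show "x \<in> lang_r B" unfolding lang_r_def by blast
qed

end


section \<open>The system with a coordinating component\<close>

text \<open>An ordinary component runs through \<open>Start\<close>, \<open>Wait\<close>,
  \<open>Act\<close> and, if \<open>R\<close> is nonempty, \<open>Back\<close>; the states with
  \<open>M\<close> are the corresponding ones of the additional component. \<open>Back\<close>
  remembers \<open>R\<close> for the bit that is set on leaving it.\<close>

datatype 'q bstate =
    Start 'q | Wait 'q | Act "(nat \<times> nat) set" 'q | Back "(nat \<times> nat) set" 'q
  | MStart | MWait "(nat \<times> nat) set" | MAct "(nat \<times> nat) set" | MBack

text \<open>\<open>Bot\<close> is the bottom symbol of the additional component; \<open>Vec R\<close> announces \<open>R\<close>.\<close>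

datatype 'g bsym = Old 'g | Ask nat | Vec "(nat \<times> nat) set" | Bot

definition pairs :: "('q, 'a, 'g) pcpa \<Rightarrow> (nat \<times> nat) set" where
  "pairs A = {1..deg A} \<times> {1..deg A}"

text \<open>If \<open>(i, j) \<in> R\<close> means that component \<open>i\<close> queries component \<open>j\<close>, then these are the
  components whose stack is sent: they are queried and do not query themselves.\<close>

definition senders :: "(nat \<times> nat) set \<Rightarrow> nat set" where
  "senders R = Range R - Domain R"

text \<open>The equations for row \<open>i\<close> of \<open>R\<close> compare the announcement with
  the top symbol. \<open>ask\<close> replaces the old query symbol by a genuine one, so that the
  answer takes its place as in \<open>A\<close>, whereas \<open>ask_vec\<close> keeps the old symbol
  beneath, since the announcement is popped again. \<open>guess\<close> refuses a nonempty
  \<open>R\<close> without senders, which would announce a communication that never happens. Every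
  rule accepts any bit and only \<open>return\<close> and \<open>sent\<close> can set it, so a bit
  lasts for one ordinary step.\<close>

inductive btrans :: "('q, 'a, 'g) pcpa \<Rightarrow> nat \<Rightarrow> 'q bstate \<times> bool \<Rightarrow> 'a option \<Rightarrow> 'g bsym \<Rightarrow>
    'q bstate \<times> bool \<Rightarrow> 'g bsym list \<Rightarrow> bool" for A i where
  ask_vec: "i \<in> {1..deg A} \<Longrightarrow> q \<in> pstates (comp A i) \<Longrightarrow> g \<in> stalph A \<Longrightarrow>
    btrans A i (Start q, b) None (Old g) (Wait q, False) [Ask (Suc (deg A)), Old g]"
| read_vec: "i \<in> {1..deg A} \<Longrightarrow> q \<in> pstates (comp A i) \<Longrightarrow> R \<subseteq> pairs A \<Longrightarrow>
    btrans A i (Wait q, b) None (Vec R) (Act R q, False) []"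
| original: "i \<in> {1..deg A} \<Longrightarrow> (p, \<beta>) \<in> ptrans (comp A i) q a g \<Longrightarrow>
    {j \<in> qidx A. qsym A j = g} = {} \<Longrightarrow>
    btrans A i (Act {} q, b) a (Old g) (Start p, False) (map Old \<beta>)"
| ask: "i \<in> {1..deg A} \<Longrightarrow> q \<in> pstates (comp A i) \<Longrightarrow> g \<in> stalph A \<Longrightarrow> R \<subseteq> pairs A \<Longrightarrow>
    R `` {i} = {j \<in> qidx A. qsym A j = g} \<Longrightarrow> (i, j) \<in> R \<Longrightarrow> j \<in> senders R \<Longrightarrow>
    btrans A i (Act R q, b) None (Old g) (Back R q, False) [Ask j]"
| keep: "i \<in> {1..deg A} \<Longrightarrow> q \<in> pstates (comp A i) \<Longrightarrow> g \<in> stalph A \<Longrightarrow> R \<subseteq> pairs A \<Longrightarrow>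
    R `` {i} = {j \<in> qidx A. qsym A j = g} \<Longrightarrow> R `` {i} \<inter> senders R = {} \<Longrightarrow> R \<noteq> {} \<Longrightarrow>
    btrans A i (Act R q, b) None (Old g) (Back R q, False) [Old g]"
| return: "i \<in> {1..deg A} \<Longrightarrow> q \<in> pstates (comp A i) \<Longrightarrow> g \<in> stalph A \<Longrightarrow> R \<subseteq> pairs A \<Longrightarrow>
    btrans A i (Back R q, b) None (Old g) (Start q, i \<in> senders R) [Old g]"
| guess: "i = Suc (deg A) \<Longrightarrow> R \<subseteq> pairs A \<Longrightarrow> R = {} \<or> senders R \<noteq> {} \<Longrightarrow>
    btrans A i (MStart, b) None Bot (MWait R, False) [Vec R]"
| sent: "i = Suc (deg A) \<Longrightarrow> R \<subseteq> pairs A \<Longrightarrow>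
    btrans A i (MWait R, b) None Bot (MAct R, True) [Bot]"
| quiet: "i = Suc (deg A) \<Longrightarrow> set_option a \<subseteq> alph A \<Longrightarrow>
    btrans A i (MAct {}, b) a Bot (MStart, False) [Bot]"
| noisy: "i = Suc (deg A) \<Longrightarrow> R \<subseteq> pairs A \<Longrightarrow> R \<noteq> {} \<Longrightarrow>
    btrans A i (MAct R, b) None Bot (MBack, False) [Bot]"
| mback: "i = Suc (deg A) \<Longrightarrow>
    btrans A i (MBack, b) None Bot (MStart, False) [Bot]"

definition bstates :: "('q, 'a, 'g) pcpa \<Rightarrow> nat \<Rightarrow> 'q bstate set" where
  "bstates A i =
     Start ` pstates (comp A i) \<union> Wait ` pstates (comp A i) \<union>
     case_prod Act ` (Pow (pairs A) \<times> pstates (comp A i)) \<union>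
     case_prod Back ` (Pow (pairs A) \<times> pstates (comp A i)) \<union>
     {MStart, MBack} \<union> MWait ` Pow (pairs A) \<union> MAct ` Pow (pairs A)"

definition bsyms :: "('q, 'a, 'g) pcpa \<Rightarrow> 'g bsym set" where
  "bsyms A = Old ` stalph A \<union> Ask ` {1..Suc (deg A)} \<union> Vec ` Pow (pairs A) \<union> {Bot}"

text \<open>States and final states leave the bit free, which gives the product form required by the
  communication property. For the additional component only \<open>MStart\<close> is final, so
  acceptance is confined to the moments between simulated steps.\<close>

definition bcomp :: "('q, 'a, 'g) pcpa \<Rightarrow> nat \<Rightarrow> ('q bstate \<times> bool, 'a, 'g bsym) pda" where
  "bcomp A i = \<lparr>
     pstates = (if i \<in> {1..deg A} then bstates A i
                else {MStart, MBack} \<union> MWait ` Pow (pairs A) \<union> MAct ` Pow (pairs A)) \<times> UNIV,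
     ptrans = (\<lambda>s a X. {(p, \<beta>). btrans A i s a X p \<beta>}),
     pinit = (if i \<in> {1..deg A} then Start (pinit (comp A i)) else MStart, False),
     pbottom = (if i \<in> {1..deg A} then Old (pbottom (comp A i)) else Bot),
     pfinal = (if i \<in> {1..deg A} then Start ` pfinal (comp A i) else {MStart}) \<times> UNIV\<rparr>"

definition coordinated :: "('q, 'a, 'g) pcpa \<Rightarrow> ('q bstate \<times> bool, 'a, 'g bsym) pcpa" where
  "coordinated A = \<lparr>deg = Suc (deg A), alph = alph A, stalph = bsyms A, comp = bcomp A,
     qsym = Ask, qidx = {1..Suc (deg A)}\<rparr>"

lemma coordinated_sel [simp]:
  "deg (coordinated A) = Suc (deg A)" "alph (coordinated A) = alph A"
  "stalph (coordinated A) = bsyms A" "comp (coordinated A) = bcomp A"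
  "qsym (coordinated A) = Ask" "qidx (coordinated A) = {1..Suc (deg A)}"
  unfolding coordinated_def by simp_all

lemma ptrans_bcomp [simp]: "(p, \<beta>) \<in> ptrans (bcomp A i) s a X \<longleftrightarrow> btrans A i s a X p \<beta>"
  unfolding bcomp_def by simp

lemma wf_pcpaD:
  assumes "wf_pcpa A"
  shows "1 \<le> deg A" "finite (alph A)" "finite (stalph A)" "qidx A \<subseteq> {1..deg A}"
    "inj_on (qsym A) {1..deg A}"
    "\<And>j. j \<in> {1..deg A} \<Longrightarrow> qsym A j \<in> stalph A"
    "\<And>i. i \<in> {1..deg A} \<Longrightarrow> finite (pstates (comp A i))"
    "\<And>i. i \<in> {1..deg A} \<Longrightarrow> pinit (comp A i) \<in> pstates (comp A i)"
    "\<And>i. i \<in> {1..deg A} \<Longrightarrow> pbottom (comp A i) \<in> stalph A"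
    "\<And>i. i \<in> {1..deg A} \<Longrightarrow> pfinal (comp A i) \<subseteq> pstates (comp A i)"
    "\<And>i q a g. i \<in> {1..deg A} \<Longrightarrow> finite (ptrans (comp A i) q a g)"
  using assms unfolding wf_pcpa_def by (simp_all add: image_subset_iff)

lemma wf_ptransD:
  assumes "wf_pcpa A" "i \<in> {1..deg A}" "(p, \<beta>) \<in> ptrans (comp A i) q a g"
  shows "q \<in> pstates (comp A i)" "g \<in> stalph A" "p \<in> pstates (comp A i)"
    "set \<beta> \<subseteq> stalph A" "set_option a \<subseteq> alph A"
proof -
  have s: "ptrans (comp A i) q a g \<subseteq> pstates (comp A i) \<times> lists (stalph A)"
    and e: "q \<notin> pstates (comp A i) \<or> g \<notin> stalph A \<or> (\<exists>b. a = Some b \<and> b \<notin> alph A) \<longrightarrow>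
      ptrans (comp A i) q a g = {}"
    using assms(1,2) unfolding wf_pcpa_def by simp_all
  show "q \<in> pstates (comp A i)" "g \<in> stalph A" "set_option a \<subseteq> alph A"
    using e assms(3) by (cases a; auto)+
  show "p \<in> pstates (comp A i)" "set \<beta> \<subseteq> stalph A" using s assms(3) by auto
qed

lemma btrans_dom:
  assumes wf: "wf_pcpa A" and "btrans A i s a X p \<beta>"
  shows "s \<in> pstates (bcomp A i) \<and> X \<in> bsyms A \<and> set_option a \<subseteq> alph A"
  using assms(2)
proof (induction rule: btrans.induct)
  case (original p \<beta> q a g b)
  then show ?case using wf_ptransD[OF wf original(1,2)] by (auto simp: bcomp_def bstates_def bsyms_def)
qed (auto simp: bcomp_def bstates_def bsyms_def)

lemma btrans_ran:
  assumes wf: "wf_pcpa A" and "btrans A i s a X p \<beta>"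
  shows "p \<in> pstates (bcomp A i) \<and> set \<beta> \<subseteq> bsyms A"
  using assms(2)
proof (induction rule: btrans.induct)
  case (original p \<beta> q a g b)
  then show ?case using wf_ptransD[OF wf original(1,2)] by (auto simp: bcomp_def bstates_def bsyms_def)
qed (auto simp: bcomp_def bstates_def bsyms_def pairs_def)

lemma finite_btrans:
  assumes wf: "wf_pcpa A" and i: "i \<in> {1..Suc (deg A)}"
  shows "finite {(p, \<beta>). btrans A i s a X p \<beta>}"
proof -
  \<comment> \<open>A finite set that contains every string a transition with top symbol
    \<open>X\<close> can write. The last union is guarded because \<open>wf_pcpa\<close> does not
    restrict \<open>comp A (Suc (deg A))\<close>, whose states and transitions may be infinite in
    number.\<close>
  define W where "W = {[], [X], [Ask (Suc (deg A)), X]} \<union> (\<lambda>R. [Vec R]) ` Pow (pairs A) \<union>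
    (\<lambda>j. [Ask j]) ` {1..deg A} \<union>
    (\<Union>q\<in>pstates (comp A i). \<Union>g\<in>stalph A. (\<lambda>t. map Old (snd t)) `
      (if i \<in> {1..deg A} then ptrans (comp A i) q a g else {}))"
  have fin: "finite (pairs A)" unfolding pairs_def by simp
  have "finite (pstates (bcomp A i))"
    using fin wf_pcpaD(7)[OF wf, of i] unfolding bcomp_def bstates_def by auto
  moreover have "finite W"
  proof (cases "i \<in> {1..deg A}")
    case True
    then show ?thesis
      using fin wf_pcpaD(3)[OF wf] wf_pcpaD(7,11)[OF wf True] unfolding W_def by simp
  next
    case False
    then have "(\<Union>q\<in>pstates (comp A i). \<Union>g\<in>stalph A. (\<lambda>t. map Old (snd t)) `
      (if i \<in> {1..deg A} then ptrans (comp A i) q a g else {})) = ({} :: 'c bsym list set)" by auto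
    then show ?thesis using fin unfolding W_def by simp
  qed
  moreover have "p \<in> pstates (bcomp A i) \<and> \<beta> \<in> W" if "btrans A i s a X p \<beta>" for p \<beta>
  proof
    show "p \<in> pstates (bcomp A i)" using btrans_ran[OF wf that] by blast
    show "\<beta> \<in> W" using that
    proof cases
      case (original p \<beta>' q g b)
      have "(\<lambda>t. map Old (snd t)) (p, \<beta>') \<in> (\<lambda>t. map Old (snd t)) `
        (if i \<in> {1..deg A} then ptrans (comp A i) q a g else {})"
        using original by (intro imageI) simp
      then show ?thesis
        using wf_ptransD(1,2)[OF wf original(5,6)] original(4) unfolding W_def snd_conv by blast
    qed (auto simp: W_def pairs_def)
  qed
  ultimately show ?thesis
    by (auto intro: finite_subset[of _ "pstates (bcomp A i) \<times> W"])
qed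

lemma wf_coordinated:
  assumes wf: "wf_pcpa A"
  shows "wf_pcpa (coordinated A)"
proof -
  have fin: "finite (pairs A)" unfolding pairs_def by simp
  have "finite (bsyms A)" using fin wf_pcpaD(3)[OF wf] unfolding bsyms_def by simp
  moreover have "finite (pstates (bcomp A i)) \<and> pinit (bcomp A i) \<in> pstates (bcomp A i) \<and>
      pbottom (bcomp A i) \<in> bsyms A \<and> pfinal (bcomp A i) \<subseteq> pstates (bcomp A i)" for i
    using fin wf_pcpaD(7-10)[OF wf, of i] unfolding bcomp_def bstates_def bsyms_def by auto
  moreover have "finite (ptrans (bcomp A i) s a X) \<and>
      ptrans (bcomp A i) s a X \<subseteq> pstates (bcomp A i) \<times> lists (bsyms A) \<and>
      (s \<notin> pstates (bcomp A i) \<or> X \<notin> bsyms A \<or> (\<exists>b. a = Some b \<and> b \<notin> alph A) \<longrightarrow>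
        ptrans (bcomp A i) s a X = {})" if "i \<in> {1..Suc (deg A)}" for i s a X
  proof -
    have "ptrans (bcomp A i) s a X = {(p, \<beta>). btrans A i s a X p \<beta>}" by (simp add: bcomp_def)
    then show ?thesis
      using finite_btrans[OF wf that, of s a X] btrans_dom[OF wf, of i s a X]
        btrans_ran[OF wf, of i s a X] by fastforce
  qed
  moreover have "Ask ` {1..Suc (deg A)} \<subseteq> bsyms A" unfolding bsyms_def by blast
  ultimately show ?thesis
    using wf_pcpaD(2)[OF wf] unfolding wf_pcpa_def coordinated_sel by (simp add: inj_on_def)
qed


section \<open>Phases of a simulated step\<close>

definition reads :: "'a option \<Rightarrow> 'a list \<Rightarrow> 'a list \<Rightarrow> bool" where
  "reads a x y \<longleftrightarrow> (case a of None \<Rightarrow> x = y | Some b \<Rightarrow> x = b # y)"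

lemma reads_simps [simp]: "reads None x y \<longleftrightarrow> x = y" "reads (Some b) x y \<longleftrightarrow> x = b # y"
  unfolding reads_def by simp_all

text \<open>\<open>s\<close> and \<open>g\<close> encode the states and stacks of \<open>A\<close>;
  \<open>m\<close>, \<open>ms\<close> and \<open>y\<close> are state, stack and unread input of the
  additional component. This is a relation and not a function, since \<open>d\<close> is left open
  at indices beyond \<open>Suc (deg A)\<close>.\<close>

definition tracks where
  "tracks A s g m ms y c d \<longleftrightarrow>
     (\<forall>i\<in>{1..deg A}. d i = (s i (cstate c i), cinput c i, g i (cstack c i))) \<and>
     d (Suc (deg A)) = (m, y, ms)"

lemma bquery_iff: "is_query (coordinated A) X \<longleftrightarrow> (\<exists>j\<in>{1..Suc (deg A)}. X = Ask j)"
  unfolding is_query_def by simp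

lemma all_indices: "(\<forall>i\<in>{1..Suc n}. P i) \<longleftrightarrow> (\<forall>i\<in>{1..n}. P i) \<and> P (Suc n)"
  using atLeastAtMostSuc_conv[of 1 n] by auto

lemma tracks_worker:
  assumes "tracks A s g m ms y c d" "i \<in> {1..deg A}"
  shows "cstate d i = s i (cstate c i)" "cinput d i = cinput c i" "cstack d i = g i (cstack c i)"
  using assms unfolding tracks_def cstate_def cinput_def cstack_def by auto

lemma tracks_master:
  assumes "tracks A s g m ms y c d"
  shows "cstate d (Suc (deg A)) = m" "cinput d (Suc (deg A)) = y" "cstack d (Suc (deg A)) = ms"
  using assms unfolding tracks_def cstate_def cinput_def cstack_def by auto

lemma tracks_all_nonempty:
  assumes "tracks A s g m ms y c d"
  shows "all_nonempty (coordinated A) d \<longleftrightarrow> (\<forall>i\<in>{1..deg A}. g i (cstack c i) \<noteq> []) \<and> ms \<noteq> []"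
  using tracks_worker(3)[OF assms] tracks_master(3)[OF assms]
  unfolding all_nonempty_def coordinated_sel all_indices by simp

lemma tracks_ordinary:
  assumes "tracks A s g m ms y c d"
    and "\<And>i. i \<in> {1..deg A} \<Longrightarrow> g i (cstack c i) \<noteq> [] \<and> (\<forall>j. hd (g i (cstack c i)) \<noteq> Ask j)"
    and "ms \<noteq> []" "\<And>j. hd ms \<noteq> Ask j"
  shows "ordinary_conf (coordinated A) d"
  using assms(2-4) tracks_all_nonempty[OF assms(1)]
  unfolding ordinary_conf_def bquery_iff coordinated_sel all_indices
  by (simp add: tracks_worker(3)[OF assms(1)] tracks_master(3)[OF assms(1)])

text \<open>With \<open>c'\<close> equal to \<open>c\<close> this yields the administrative steps,
  which only change the encoding; with a successor \<open>c'\<close> of \<open>c\<close> it yields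
  the simulated ordinary step.\<close>

lemma tracks_ord_stepI:
  assumes t: "tracks A s g m ms y c d" and o: "ordinary_conf (coordinated A) d"
    and w: "\<And>i. i \<in> {1..deg A} \<Longrightarrow> \<exists>a \<beta>. reads a (cinput c i) (cinput c' i) \<and>
      btrans A i (s i (cstate c i)) a (hd (g i (cstack c i))) (s' i (cstate c' i)) \<beta> \<and>
      g' i (cstack c' i) = \<beta> @ tl (g i (cstack c i))"
    and m: "reads a y y'" "btrans A (Suc (deg A)) m a (hd ms) m' \<beta>" "ms' = \<beta> @ tl ms"
  shows "\<exists>d'. ord_step (coordinated A) d d' \<and> tracks A s' g' m' ms' y' c' d'"
proof -
  define d' where "d' i = (if i = Suc (deg A) then (m', y', ms')
    else if i \<in> {1..deg A} then (s' i (cstate c' i), cinput c' i, g' i (cstack c' i)) else d i)" for i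
  have tr: "tracks A s' g' m' ms' y' c' d'" unfolding tracks_def d'_def by auto
  have "\<exists>a y p \<beta>. reads a (cinput d i) y \<and>
     btrans A i (cstate d i) a (hd (cstack d i)) p \<beta> \<and> d' i = (p, y, \<beta> @ tl (cstack d i))"
    if "i \<in> {1..deg A}" for i
  proof -
    have "d' i = (s' i (cstate c' i), cinput c' i, g' i (cstack c' i))"
      using that unfolding d'_def by simp
    then show ?thesis using w[OF that] unfolding tracks_worker[OF t that] by metis
  qed
  moreover have "\<exists>a y p \<beta>. reads a (cinput d (Suc (deg A))) y \<and>
     btrans A (Suc (deg A)) (cstate d (Suc (deg A))) a (hd (cstack d (Suc (deg A)))) p \<beta> \<and>
     d' (Suc (deg A)) = (p, y, \<beta> @ tl (cstack d (Suc (deg A))))"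
    using m tr unfolding tracks_master[OF t] tracks_def by blast
  ultimately have "ord_step (coordinated A) d d'"
    using o unfolding ord_step_def coordinated_sel all_indices ptrans_bcomp reads_def[symmetric]
    by (simp add: d'_def)
  then show ?thesis using tr by blast
qed

lemma tracks_ord_stepD:
  assumes t: "tracks A s g m ms y c d" and o: "ord_step (coordinated A) d d'"
  shows "i \<in> {1..deg A} \<Longrightarrow> \<exists>a x p \<beta>. reads a (cinput c i) x \<and>
      btrans A i (s i (cstate c i)) a (hd (g i (cstack c i))) p \<beta> \<and>
      d' i = (p, x, \<beta> @ tl (g i (cstack c i)))"
    and "\<exists>a x p \<beta>. reads a y x \<and> btrans A (Suc (deg A)) m a (hd ms) p \<beta> \<and>
      d' (Suc (deg A)) = (p, x, \<beta> @ tl ms)"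
proof -
  have *: "\<forall>i\<in>{1..Suc (deg A)}. \<exists>a y p \<beta>. reads a (cinput d i) y \<and>
     btrans A i (cstate d i) a (hd (cstack d i)) p \<beta> \<and> d' i = (p, y, \<beta> @ tl (cstack d i))"
    using o unfolding ord_step_def coordinated_sel ptrans_bcomp reads_def by blast
  show "\<exists>a x p \<beta>. reads a (cinput c i) x \<and>
      btrans A i (s i (cstate c i)) a (hd (g i (cstack c i))) p \<beta> \<and>
      d' i = (p, x, \<beta> @ tl (g i (cstack c i)))" if "i \<in> {1..deg A}"
    using conjunct1[OF *[unfolded all_indices], rule_format, OF that]
    unfolding tracks_worker[OF t that] .
  show "\<exists>a x p \<beta>. reads a y x \<and> btrans A (Suc (deg A)) m a (hd ms) p \<beta> \<and>
      d' (Suc (deg A)) = (p, x, \<beta> @ tl ms)"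
    using conjunct2[OF *[unfolded all_indices]] unfolding tracks_master[OF t] .
qed

section \<open>The relation of pending queries and the six phases\<close>

text \<open>This is the one correct value of the guessed \<open>R\<close> when the system
  \<open>A\<close> is in configuration \<open>c\<close>.\<close>

definition query_pairs :: "('q, 'a, 'g) pcpa \<Rightarrow> ('q, 'a, 'g) conf \<Rightarrow> (nat \<times> nat) set" where
  "query_pairs A c = {(i, j). i \<in> {1..deg A} \<and> j \<in> qidx A \<and> qsym A j = hd (cstack c i)}"

text \<open>For \<open>R = query_pairs A c\<close> each row has at most one element, which justifies
  \<open>THE\<close>. Queries that will not be answered stay \<open>Old\<close> and trigger
  nothing.\<close>

definition ask_stack :: "(nat \<times> nat) set \<Rightarrow> nat \<Rightarrow> 'g list \<Rightarrow> 'g bsym list" where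
  "ask_stack R i \<gamma> = (if R `` {i} \<inter> senders R \<noteq> {}
     then Ask (THE j. (i, j) \<in> R) # map Old (tl \<gamma>) else map Old \<gamma>)"

text \<open>One communication step leads from asking to told and from query to return; all other
  transitions between phases are ordinary. Bits may be set in two phases only: in the start phase
  those of the components that have just sent, in the act phase that of the additional
  component.\<close>

abbreviation "start_phase A b \<equiv>
  tracks A (\<lambda>i q. (Start q, b i)) (\<lambda>i. map Old) (MStart, False) [Bot]"
abbreviation "asking_phase A R \<equiv>
  tracks A (\<lambda>i q. (Wait q, False)) (\<lambda>i \<gamma>. Ask (Suc (deg A)) # map Old \<gamma>) (MWait R, False) [Vec R]"
abbreviation "told_phase A R \<equiv>
  tracks A (\<lambda>i q. (Wait q, False)) (\<lambda>i \<gamma>. Vec R # map Old \<gamma>) (MWait R, False) [Bot]"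
abbreviation "act_phase A R \<equiv>
  tracks A (\<lambda>i q. (Act R q, False)) (\<lambda>i. map Old) (MAct R, True) [Bot]"
abbreviation "query_phase A R \<equiv>
  tracks A (\<lambda>i q. (Back R q, False)) (ask_stack R) (MBack, False) [Bot]"
abbreviation "return_phase A R \<equiv>
  tracks A (\<lambda>i q. (Back R q, False)) (\<lambda>i. map Old) (MBack, False) [Bot]"

lemma query_pairs_subset: "wf_pcpa A \<Longrightarrow> query_pairs A c \<subseteq> pairs A"
  using wf_pcpaD(4)[of A] unfolding query_pairs_def pairs_def by blast

lemma query_pairs_Image:
  "i \<in> {1..deg A} \<Longrightarrow> query_pairs A c `` {i} = {j \<in> qidx A. qsym A j = hd (cstack c i)}"
  unfolding query_pairs_def by auto

lemma query_pairs_unique: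
  assumes "wf_pcpa A" "(i, j) \<in> query_pairs A c" "(i, k) \<in> query_pairs A c"
  shows "j = k"
proof -
  have "j \<in> {1..deg A}" "k \<in> {1..deg A}" "qsym A j = qsym A k"
    using assms(2,3) wf_pcpaD(4)[OF assms(1)] unfolding query_pairs_def by auto
  then show ?thesis using wf_pcpaD(5)[OF assms(1)] by (meson inj_onD)
qed

lemma query_pairs_Domain:
  "i \<in> {1..deg A} \<Longrightarrow> i \<in> Domain (query_pairs A c) \<longleftrightarrow> is_query A (hd (cstack c i))"
  unfolding query_pairs_def is_query_def by force

text \<open>A component lies in the domain of the relation exactly if its own top symbol is a query
  symbol. So \<open>R\<close> alone tells each component what the communication step of
  \<open>A\<close> does to it.\<close>

lemma answers_iff_senders:
  assumes "wf_pcpa A" "i \<in> {1..deg A}"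
  shows "answers A c i j \<longleftrightarrow> (i, j) \<in> query_pairs A c \<and> j \<in> senders (query_pairs A c)"
proof (cases "j \<in> qidx A")
  case True
  then have j: "j \<in> {1..deg A}" using wf_pcpaD(4)[OF assms(1)] by blast
  have "(i, j) \<in> query_pairs A c \<longleftrightarrow> hd (cstack c i) = qsym A j"
    using True assms(2) unfolding query_pairs_def by auto
  then show ?thesis
    using query_pairs_Domain[OF j, of c] True unfolding answers_def senders_def by blast
next
  case False
  then show ?thesis unfolding answers_def query_pairs_def by simp
qed

lemma query_pairs_empty:
  "query_pairs A c = {} \<longleftrightarrow> (\<forall>i\<in>{1..deg A}. \<not> is_query A (hd (cstack c i)))"
proof -
  have "query_pairs A c = {} \<longleftrightarrow> Domain (query_pairs A c) = {}" by (simp add: Domain_empty_iff)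
  moreover have "Domain (query_pairs A c) \<subseteq> {1..deg A}" unfolding query_pairs_def by blast
  moreover have "(\<forall>i\<in>{1..deg A}. i \<notin> Domain (query_pairs A c)) \<longleftrightarrow>
      (\<forall>i\<in>{1..deg A}. \<not> is_query A (hd (cstack c i)))"
    by (rule ball_cong[OF refl]) (simp only: query_pairs_Domain)
  ultimately show ?thesis by blast
qed

lemma comm_conf_iff: "comm_conf A c \<longleftrightarrow> all_nonempty A c \<and> query_pairs A c \<noteq> {}"
  unfolding comm_conf_def query_pairs_empty by blast

lemma ordinary_conf_iff: "ordinary_conf A c \<longleftrightarrow> all_nonempty A c \<and> query_pairs A c = {}"
  unfolding ordinary_conf_def query_pairs_empty by blast

lemma ask_stack_ask:
  assumes "wf_pcpa A" "(i, j) \<in> query_pairs A c" "j \<in> senders (query_pairs A c)"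
  shows "ask_stack (query_pairs A c) i \<gamma> = Ask j # map Old (tl \<gamma>)"
proof -
  have "(THE k. (i, k) \<in> query_pairs A c) = j"
    using assms query_pairs_unique by (intro the_equality) blast+
  then show ?thesis using assms(2,3) unfolding ask_stack_def by auto
qed

lemma ask_stack_keep:
  "R `` {i} \<inter> senders R = {} \<Longrightarrow> ask_stack R i \<gamma> = map Old \<gamma>"
  unfolding ask_stack_def by simp

text \<open>Turns the local checks into a global one: every component vouches for its own row, and
  \<open>R \<subseteq> pairs A\<close> leaves no further rows.\<close>

lemma query_pairsI:
  assumes "R \<subseteq> pairs A" "\<And>i. i \<in> {1..deg A} \<Longrightarrow> R `` {i} = {j \<in> qidx A. qsym A j = hd (cstack c i)}"
  shows "R = query_pairs A c"
proof -
  have "(i, j) \<in> R \<longleftrightarrow> (i, j) \<in> query_pairs A c" for i j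
  proof (cases "i \<in> {1..deg A}")
    case True
    then show ?thesis using assms(2)[OF True] query_pairs_Image[OF True, of c] by blast
  next
    case False
    then show ?thesis using assms(1) unfolding pairs_def query_pairs_def by blast
  qed
  then show ?thesis by auto
qed


section \<open>Ordinary steps lead from phase to phase\<close>

inductive_cases btrans_StartE: "btrans A i (Start q, b) a X p \<beta>"
inductive_cases btrans_WaitE: "btrans A i (Wait q, b) a X p \<beta>"
inductive_cases btrans_ActE: "btrans A i (Act R q, b) a X p \<beta>"
inductive_cases btrans_BackE: "btrans A i (Back R q, b) a X p \<beta>"
inductive_cases btrans_MStartE: "btrans A i (MStart, b) a X p \<beta>"
inductive_cases btrans_MWaitE: "btrans A i (MWait R, b) a X p \<beta>"
inductive_cases btrans_MActE: "btrans A i (MAct R, b) a X p \<beta>"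
inductive_cases btrans_MBackE: "btrans A i (MBack, b) a X p \<beta>"

lemma start_phase_step:
  assumes t: "start_phase A b y c d" and o: "ord_step (coordinated A) d d'"
    and ne: "all_nonempty A c"
  shows "\<exists>R. R \<subseteq> pairs A \<and> (R = {} \<or> senders R \<noteq> {}) \<and> asking_phase A R y c d'"
proof -
  obtain R where R: "R \<subseteq> pairs A" "R = {} \<or> senders R \<noteq> {}"
    and m: "d' (Suc (deg A)) = ((MWait R, False), y, [Vec R])"
  proof -
    assume *: "\<And>R. R \<subseteq> pairs A \<Longrightarrow> R = {} \<or> senders R \<noteq> {} \<Longrightarrow>
      d' (Suc (deg A)) = ((MWait R, False), y, [Vec R]) \<Longrightarrow> thesis"
    obtain a x p \<beta> where "reads a y x" "btrans A (Suc (deg A)) (MStart, False) a Bot p \<beta>"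
      "d' (Suc (deg A)) = (p, x, \<beta>)"
      using tracks_ord_stepD(2)[OF t o, unfolded list.sel append_Nil2] by blast
    then show thesis by (elim btrans_MStartE) (simp add: *)
  qed
  have "d' i = ((Wait (cstate c i), False), cinput c i, Ask (Suc (deg A)) # map Old (cstack c i))"
    if i: "i \<in> {1..deg A}" for i
  proof -
    obtain g r where g: "cstack c i = g # r"
      using ne i unfolding all_nonempty_def by (meson neq_Nil_conv)
    show ?thesis using tracks_ord_stepD(1)[OF t o i] unfolding g by (auto elim!: btrans_StartE)
  qed
  then have "asking_phase A R y c d'" using m unfolding tracks_def by blast
  then show ?thesis using R by blast
qed

lemma told_phase_step:
  assumes t: "told_phase A R y c d" and o: "ord_step (coordinated A) d d'"
  shows "act_phase A R y c d'"
proof -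
  have m: "d' (Suc (deg A)) = ((MAct R, True), y, [Bot])"
    using tracks_ord_stepD(2)[OF t o] by (auto elim!: btrans_MWaitE)
  have "d' i = ((Act R (cstate c i), False), cinput c i, map Old (cstack c i))"
    if i: "i \<in> {1..deg A}" for i
    using tracks_ord_stepD(1)[OF t o i] by (auto elim!: btrans_WaitE)
  then show ?thesis using m unfolding tracks_def by blast
qed

lemma return_phase_step:
  assumes t: "return_phase A R y c d" and o: "ord_step (coordinated A) d d'"
    and ne: "all_nonempty A c"
  shows "start_phase A (\<lambda>i. i \<in> senders R) y c d'"
proof -
  have m: "d' (Suc (deg A)) = ((MStart, False), y, [Bot])"
    using tracks_ord_stepD(2)[OF t o] by (auto elim!: btrans_MBackE)
  have "d' i = ((Start (cstate c i), i \<in> senders R), cinput c i, map Old (cstack c i))"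
    if i: "i \<in> {1..deg A}" for i
  proof -
    obtain g r where g: "cstack c i = g # r"
      using ne i unfolding all_nonempty_def by (meson neq_Nil_conv)
    show ?thesis using tracks_ord_stepD(1)[OF t o i] unfolding g by (auto elim!: btrans_BackE)
  qed
  then show ?thesis using m unfolding tracks_def by blast
qed

text \<open>For nonempty \<open>R\<close> the only transitions out of \<open>Act R q\<close> are
  \<open>ask\<close> and \<open>keep\<close>, and both test row \<open>i\<close>. A wrong guess
  therefore blocks some component, and with it the whole system.\<close>

lemma act_phase_query_step:
  assumes wf: "wf_pcpa A" and t: "act_phase A R y c d" and o: "ord_step (coordinated A) d d'"
    and ne: "all_nonempty A c" and R: "R \<subseteq> pairs A" "R \<noteq> {}"
  shows "R = query_pairs A c \<and> query_phase A R y c d'"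
proof
  have w: "R `` {i} = {j \<in> qidx A. qsym A j = hd (cstack c i)} \<and>
    ((\<exists>j. (i, j) \<in> R \<and> j \<in> senders R \<and>
        d' i = ((Back R (cstate c i), False), cinput c i, Ask j # map Old (tl (cstack c i)))) \<or>
     (R `` {i} \<inter> senders R = {} \<and>
        d' i = ((Back R (cstate c i), False), cinput c i, map Old (cstack c i))))"
    if i: "i \<in> {1..deg A}" for i
  proof -
    obtain g r where g: "cstack c i = g # r"
      using ne i unfolding all_nonempty_def by (meson neq_Nil_conv)
    show ?thesis
      using tracks_ord_stepD(1)[OF t o i] R(2) unfolding g by (auto elim!: btrans_ActE)
  qed
  show eq: "R = query_pairs A c" using R(1) conjunct1[OF w] by (rule query_pairsI)
  have m: "d' (Suc (deg A)) = ((MBack, False), y, [Bot])"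
    using tracks_ord_stepD(2)[OF t o] R(2) by (auto elim!: btrans_MActE)
  have "d' i = ((Back R (cstate c i), False), cinput c i, ask_stack R i (cstack c i))"
    if i: "i \<in> {1..deg A}" for i
    using conjunct2[OF w[OF i]]
  proof (elim disjE exE conjE)
    fix j assume "(i, j) \<in> R" "j \<in> senders R"
      "d' i = ((Back R (cstate c i), False), cinput c i, Ask j # map Old (tl (cstack c i)))"
    then show ?thesis using ask_stack_ask[OF wf, of i j c "cstack c i"] eq by simp
  next
    assume "R `` {i} \<inter> senders R = {}"
      "d' i = ((Back R (cstate c i), False), cinput c i, map Old (cstack c i))"
    then show ?thesis by (simp add: ask_stack_keep)
  qed
  then show "query_phase A R y c d'" using m unfolding tracks_def by blast
qed

text \<open>For empty \<open>R\<close> only \<open>original\<close> applies, which excludes query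
  symbols on top; so the announcement is correct and every component has made a transition of
  \<open>A\<close>.\<close>

lemma act_phase_quiet_step:
  assumes t: "act_phase A {} y c d" and o: "ord_step (coordinated A) d d'"
    and ne: "all_nonempty A c"
  shows "\<exists>c' y'. ord_step A c c' \<and> start_phase A (\<lambda>i. False) y' c' d'"
proof -
  \<comment> \<open>\<open>t\<close> is a local configuration that component \<open>i\<close> of
    \<open>A\<close> can reach in one transition and that \<open>d' i\<close> encodes.\<close>
  define P where "P i t \<longleftrightarrow>
      (\<exists>a x p \<beta>. t = (p, x, \<beta> @ tl (cstack c i)) \<and> reads a (cinput c i) x \<and>
        (p, \<beta>) \<in> ptrans (comp A i) (cstate c i) a (hd (cstack c i))) \<and>
      {j \<in> qidx A. qsym A j = hd (cstack c i)} = {} \<and>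
      d' i = ((Start (fst t), False), fst (snd t), map Old (snd (snd t)))" for i t
  have w: "\<exists>t. P i t" if i: "i \<in> {1..deg A}" for i
  proof -
    obtain g r where g: "cstack c i = g # r"
      using ne i unfolding all_nonempty_def by (meson neq_Nil_conv)
    obtain a x p \<beta> where a: "reads a (cinput c i) x"
      and b: "btrans A i (Act {} (cstate c i), False) a (Old g) p \<beta>"
      and d': "d' i = (p, x, \<beta> @ map Old r)"
      using tracks_ord_stepD(1)[OF t o i, unfolded g list.map list.sel] by blast
    from b obtain p' \<beta>' where p: "p = (Start p', False)" "\<beta> = map Old \<beta>'"
      "(p', \<beta>') \<in> ptrans (comp A i) (cstate c i) a g" "{j \<in> qidx A. qsym A j = g} = {}"
      by (rule btrans_ActE) auto
    have "P i (p', x, \<beta>' @ r)" unfolding P_def g list.sel using a d' p by auto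
    then show ?thesis by blast
  qed
  \<comment> \<open>The transitions are known for each component separately; a choice assembles
    their results into one configuration of \<open>A\<close>.\<close>
  define c' where "c' i = (if i \<in> {1..deg A} then SOME t. P i t else c i)" for i
  have P: "P i (c' i)" if i: "i \<in> {1..deg A}" for i
    using someI_ex[OF w[OF i]] i unfolding c'_def by (simp only: if_True)
  note c' = P[unfolded P_def]
  have "{} `` {i} = {j \<in> qidx A. qsym A j = hd (cstack c i)}" if "i \<in> {1..deg A}" for i
    using c'[OF that] by simp
  then have "{} = query_pairs A c" by (rule query_pairsI[OF empty_subsetI])
  then have "ordinary_conf A c" using ne unfolding ordinary_conf_iff by simp
  moreover have "c' i = c i" if "i \<notin> {1..deg A}" for i
    using that unfolding c'_def by (rule if_not_P)
  ultimately have "ord_step A c c'"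
    unfolding ord_step_def reads_def[symmetric] using c' by meson
  moreover obtain y' where "d' (Suc (deg A)) = ((MStart, False), y', [Bot])"
    using tracks_ord_stepD(2)[OF t o] by (auto elim!: btrans_MActE)
  then have "start_phase A (\<lambda>i. False) y' c' d'"
    using c' unfolding tracks_def cstate_def cinput_def cstack_def by blast
  ultimately show ?thesis by blast
qed


section \<open>Communication steps lead from phase to phase\<close>

lemma comm_succ_reset:
  assumes "i \<in> {1..deg A}" "\<nexists>j. answers A c i j" "k \<in> {1..deg A}" "answers A c k i"
  shows "comm_succ A c i = (cstate c i, cinput c i, [pbottom (comp A i)])"
  using assms unfolding comm_succ_def by auto

lemma comm_succ_unchanged:
  assumes "i \<in> {1..deg A}" "\<nexists>j. answers A c i j" "\<not> (\<exists>k\<in>{1..deg A}. answers A c k i)"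
  shows "comm_succ A c i = (cstate c i, cinput c i, cstack c i)"
  using assms unfolding comm_succ_def by auto

text \<open>All ordinary components query the additional one, whose top symbol \<open>Vec R\<close>
  is no query symbol; so each receives a copy of \<open>[Vec R]\<close>, and there is a single
  sender. That somebody asks at all is due to \<open>deg A\<close> being at least 1.\<close>

lemma asking_phase_comm:
  assumes wf: "wf_pcpa A" and t: "asking_phase A R y c d"
  shows "comm_conf (coordinated A) d"
    and "told_phase A R y c (comm_succ (coordinated A) d)"
    and "sends (coordinated A) d j \<longleftrightarrow> j = Suc (deg A)"
proof -
  let ?N = "Suc (deg A)"
  have ne: "all_nonempty (coordinated A) d" using tracks_all_nonempty[OF t] by simp
  have hd: "hd (cstack d i) = Ask ?N" if "i \<in> {1..deg A}" for i
    using tracks_worker(3)[OF t that] by simp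
  have hdN: "cstack d ?N = [Vec R]" using tracks_master(3)[OF t] .
  have ans: "answers (coordinated A) d i k \<longleftrightarrow> k = ?N" if "i \<in> {1..deg A}" for i k
    using hd[OF that] hdN unfolding answers_def bquery_iff by auto
  have ansN: "\<not> answers (coordinated A) d ?N k" for k
    using hdN unfolding answers_def by simp
  have 1: "1 \<in> {1..deg A}" using wf_pcpaD(1)[OF wf] by simp
  show cc: "comm_conf (coordinated A) d"
    using ne hd[OF 1] 1 unfolding comm_conf_def bquery_iff coordinated_sel by force
  have "comm_succ (coordinated A) d i =
      ((Wait (cstate c i), False), cinput c i, Vec R # map Old (cstack c i))"
    if i: "i \<in> {1..deg A}" for i
    using comm_succ_stack[OF wf_coordinated[OF wf] _ iffD2[OF ans[OF i] refl]] i
    by (simp add: hdN tracks_worker[OF t i])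
  moreover have "comm_succ (coordinated A) d ?N = ((MWait R, False), y, [Bot])"
    using comm_succ_reset[of ?N "coordinated A" d 1] ansN ans[OF 1]
    by (simp add: tracks_master[OF t] bcomp_def)
  ultimately show "told_phase A R y c (comm_succ (coordinated A) d)" unfolding tracks_def by blast
  show "sends (coordinated A) d j \<longleftrightarrow> j = ?N"
  proof
    assume "sends (coordinated A) d j"
    then show "j = ?N"
      using ans ansN unfolding sends_def coordinated_sel by (metis atLeastAtMost_iff le_SucE)
  next
    assume "j = ?N"
    then show "sends (coordinated A) d j"
      using cc ans[OF 1] 1 tracks_worker(1)[OF t 1] tracks_master(1)[OF t]
      unfolding sends_def coordinated_sel by force
  qed
qed

text \<open>A sender is outside the domain of \<open>R\<close>, so it keeps its \<open>Old\<close>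
  stack, whose top is no query symbol. Hence every genuine query is answered, \<open>answers\<close>
  is the same relation on \<open>1..deg A\<close> in both systems, and one communication step of
  each moves the same stacks.\<close>

lemma query_phase_comm:
  assumes wf: "wf_pcpa A" and ne: "all_nonempty A c"
    and R: "R = query_pairs A c" "senders R \<noteq> {}" and t: "query_phase A R y c d"
  shows "comm_conf A c" and "all_nonempty A (comm_succ A c)"
    and "comm_conf (coordinated A) d"
    and "return_phase A R y (comm_succ A c) (comm_succ (coordinated A) d)"
    and "sends (coordinated A) d j \<longleftrightarrow> j \<in> senders R"
proof -
  let ?N = "Suc (deg A)"
  have sub: "senders R \<subseteq> {1..deg A}"
    using query_pairs_subset[OF wf, of c] R(1) unfolding senders_def pairs_def by auto
  have hdN: "cstack d ?N = [Bot]" using tracks_master(3)[OF t] .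
  have st: "cstack d i = Ask j # map Old (tl (cstack c i))" if "(i, j) \<in> R" "j \<in> senders R" for i j
  proof -
    have i: "i \<in> {1..deg A}" using that(1) R(1) unfolding query_pairs_def by blast
    show ?thesis using tracks_worker(3)[OF t i] ask_stack_ask[OF wf, of i j c] that R(1) by simp
  qed
  have st': "cstack d i = map Old (cstack c i)"
    if "i \<in> {1..deg A}" "R `` {i} \<inter> senders R = {}" for i
    using tracks_worker(3)[OF t that(1)] ask_stack_keep[OF that(2)] by simp
  have cne: "cstack c i \<noteq> []" if "i \<in> {1..deg A}" for i
    using ne that unfolding all_nonempty_def by blast
  have ans: "answers (coordinated A) d i j \<longleftrightarrow> (i, j) \<in> R \<and> j \<in> senders R"
    if i: "i \<in> {1..deg A}" for i j
  proof
    assume a: "(i, j) \<in> R \<and> j \<in> senders R"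
    then have j: "j \<in> {1..deg A}" "j \<notin> Domain R" using sub unfolding senders_def by auto
    have "cstack d j = map Old (cstack c j)" using j by (intro st') auto
    then have "\<not> is_query (coordinated A) (hd (cstack d j))"
      using cne[OF j(1)] unfolding bquery_iff by (simp add: list.map_sel(1))
    then show "answers (coordinated A) d i j"
      using st[of i j] a j(1) unfolding answers_def by simp
  next
    assume a: "answers (coordinated A) d i j"
    then have h: "hd (cstack d i) = Ask j" unfolding answers_def by simp
    show "(i, j) \<in> R \<and> j \<in> senders R"
    proof (cases "R `` {i} \<inter> senders R = {}")
      case True
      then show ?thesis using h st'[OF i True] cne[OF i] by (simp add: list.map_sel(1))
    next
      case False
      then obtain k where k: "(i, k) \<in> R" "k \<in> senders R" by blast
      then show ?thesis using st[OF k] h by simp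
    qed
  qed
  have ansA: "answers A c i j \<longleftrightarrow> (i, j) \<in> R \<and> j \<in> senders R" if "i \<in> {1..deg A}" for i j
    using answers_iff_senders[OF wf that] R(1) by simp
  have ansN: "\<not> answers (coordinated A) d ?N k" for k
    using hdN unfolding answers_def by simp
  have Nans: "\<not> answers (coordinated A) d k ?N" if "k \<in> {1..deg A}" for k
    using ans[OF that] sub by auto
  have bne: "all_nonempty (coordinated A) d"
    using tracks_all_nonempty[OF t] cne unfolding ask_stack_def by simp
  obtain i0 j0 where ij: "(i0, j0) \<in> R" "j0 \<in> senders R"
    using R(2) unfolding senders_def by blast
  then have i0: "i0 \<in> {1..deg A}" using R(1) unfolding query_pairs_def by blast
  show "comm_conf A c" using ne ij R(1) unfolding comm_conf_iff by blast
  have "answers (coordinated A) d i0 j0" using ans[OF i0] ij by blast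
  then show cc: "comm_conf (coordinated A) d"
    using bne i0 answers_imp_query unfolding comm_conf_def coordinated_sel
    by (metis atLeastAtMost_iff le_Suc_eq)
  have main: "comm_succ (coordinated A) d i =
      ((Back R (cstate (comm_succ A c) i), False), cinput (comm_succ A c) i,
        map Old (cstack (comm_succ A c) i)) \<and> cstack (comm_succ A c) i \<noteq> []"
    if i: "i \<in> {1..deg A}" for i
  proof -
    have iB: "i \<in> {1..deg (coordinated A)}" using i by simp
    \<comment> \<open>The case \<open>idle\<close> includes components whose own query remains
      unanswered because its target is querying too.\<close>
    consider (asks) j where "(i, j) \<in> R" "j \<in> senders R"
      | (asked) k where "R `` {i} \<inter> senders R = {}" "(k, i) \<in> R" "i \<in> senders R"
      | (idle) "R `` {i} \<inter> senders R = {}" "i \<notin> senders R"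
      unfolding senders_def by blast
    then show ?thesis
    proof cases
      case asks
      then have j: "j \<in> {1..deg A}" "R `` {j} \<inter> senders R = {}"
        using sub unfolding senders_def by auto
      have "answers A c i j" "answers (coordinated A) d i j" using ans[OF i] ansA[OF i] asks by auto
      then show ?thesis
        using comm_succ_stack[OF wf i, of c j] comm_succ_stack[OF wf_coordinated[OF wf] iB, of d j]
          st[OF asks] st'[OF j] cne[OF j(1)]
        by (simp add: tracks_worker[OF t i] cstate_def[of "comm_succ A c"]
            cinput_def[of "comm_succ A c"] cstack_def[of "comm_succ A c"])
    next
      case asked
      then have k: "k \<in> {1..deg A}" using R(1) unfolding query_pairs_def by blast
      have kB: "k \<in> {1..deg (coordinated A)}" using k by simp
      have "answers A c k i" "answers (coordinated A) d k i" using ans[OF k] ansA[OF k] asked by auto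
      moreover have "\<nexists>j. answers A c i j" "\<nexists>j. answers (coordinated A) d i j"
        using ans[OF i] ansA[OF i] asked(1) by auto
      ultimately show ?thesis
        using comm_succ_reset[OF i _ k, of c] comm_succ_reset[OF iB _ kB, of d] i
        by (simp add: tracks_worker[OF t i] cstate_def[of "comm_succ A c"]
            cinput_def[of "comm_succ A c"] cstack_def[of "comm_succ A c"] bcomp_def)
    next
      case idle
      have "\<not> (\<exists>k\<in>{1..deg A}. answers A c k i)" using ansA idle(2) by blast
      moreover have "\<not> (\<exists>k\<in>{1..deg (coordinated A)}. answers (coordinated A) d k i)"
        using ans idle(2) ansN by (metis atLeastAtMost_iff coordinated_sel(1) le_SucE)
      moreover have "\<nexists>j. answers A c i j" "\<nexists>j. answers (coordinated A) d i j"
        using ans[OF i] ansA[OF i] idle(1) by auto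
      ultimately show ?thesis
        using comm_succ_unchanged[OF i, of c] comm_succ_unchanged[OF iB, of d] st'[OF i idle(1)] cne[OF i]
        by (simp add: tracks_worker(1,2)[OF t i] cstate_def[of "comm_succ A c"]
            cinput_def[of "comm_succ A c"] cstack_def[of "comm_succ A c"])
    qed
  qed
  show "all_nonempty A (comm_succ A c)" using main unfolding all_nonempty_def by blast
  have "\<not> (\<exists>k\<in>{1..deg (coordinated A)}. answers (coordinated A) d k ?N)"
    using Nans ansN by (metis atLeastAtMost_iff coordinated_sel(1) le_SucE)
  then have "comm_succ (coordinated A) d ?N = ((MBack, False), y, [Bot])"
    using comm_succ_unchanged[of ?N "coordinated A" d] ansN by (simp add: tracks_master[OF t])
  then show "return_phase A R y (comm_succ A c) (comm_succ (coordinated A) d)"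
    using main unfolding tracks_def by blast
  show "sends (coordinated A) d j \<longleftrightarrow> j \<in> senders R"
  proof
    assume "sends (coordinated A) d j"
    then show "j \<in> senders R"
      using ans ansN unfolding sends_def coordinated_sel by (metis atLeastAtMost_iff le_SucE)
  next
    assume j: "j \<in> senders R"
    then obtain i where i: "(i, j) \<in> R" unfolding senders_def by blast
    then have i': "i \<in> {1..deg A}" using R(1) unfolding query_pairs_def by blast
    have j': "j \<in> {1..deg A}" using j sub by blast
    have "answers (coordinated A) d i j \<and> \<not> snd (cstate d i) \<and> \<not> snd (cstate d j)"
      using ans[OF i'] i j tracks_worker(1)[OF t i'] tracks_worker(1)[OF t j'] by simp
    moreover have "i \<in> {1..deg (coordinated A)}" using i' by simp
    ultimately show "sends (coordinated A) d j" using cc unfolding sends_def by blast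
  qed
qed


lemma start_phase_ordinary:
  assumes "start_phase A b y c d" "all_nonempty A c"
  shows "ordinary_conf (coordinated A) d"
  by (rule tracks_ordinary[OF assms(1)])
    (use assms(2) in \<open>auto simp: all_nonempty_def list.map_sel(1)\<close>)

lemma told_phase_ordinary: "told_phase A R y c d \<Longrightarrow> ordinary_conf (coordinated A) d"
  by (rule tracks_ordinary) auto

lemma act_phase_ordinary:
  assumes "act_phase A R y c d" "all_nonempty A c"
  shows "ordinary_conf (coordinated A) d"
  by (rule tracks_ordinary[OF assms(1)])
    (use assms(2) in \<open>auto simp: all_nonempty_def list.map_sel(1)\<close>)

lemma return_phase_ordinary:
  assumes "return_phase A R y c d" "all_nonempty A c"
  shows "ordinary_conf (coordinated A) d"
  by (rule tracks_ordinary[OF assms(1)])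
    (use assms(2) in \<open>auto simp: all_nonempty_def list.map_sel(1)\<close>)

section \<open>Invariants of the coordinated system\<close>

text \<open>The last argument collects the components that have answered a query since the last
  ordinary step.\<close>

inductive reachable_phase for A x where
  start: "(rstep A)\<^sup>*\<^sup>* (init_conf A x) c \<Longrightarrow> start_phase A b y c d \<Longrightarrow> reachable_phase A x d {}"
| asking: "(rstep A)\<^sup>*\<^sup>* (init_conf A x) c \<Longrightarrow> all_nonempty A c \<Longrightarrow> R \<subseteq> pairs A \<Longrightarrow>
    R = {} \<or> senders R \<noteq> {} \<Longrightarrow> asking_phase A R y c d \<Longrightarrow> reachable_phase A x d {}"
| told: "(rstep A)\<^sup>*\<^sup>* (init_conf A x) c \<Longrightarrow> all_nonempty A c \<Longrightarrow> R \<subseteq> pairs A \<Longrightarrow>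
    R = {} \<or> senders R \<noteq> {} \<Longrightarrow> told_phase A R y c d \<Longrightarrow> reachable_phase A x d {Suc (deg A)}"
| act: "(rstep A)\<^sup>*\<^sup>* (init_conf A x) c \<Longrightarrow> all_nonempty A c \<Longrightarrow> R \<subseteq> pairs A \<Longrightarrow>
    R = {} \<or> senders R \<noteq> {} \<Longrightarrow> act_phase A R y c d \<Longrightarrow> reachable_phase A x d {}"
| query: "(rstep A)\<^sup>*\<^sup>* (init_conf A x) c \<Longrightarrow> all_nonempty A c \<Longrightarrow> R = query_pairs A c \<Longrightarrow>
    senders R \<noteq> {} \<Longrightarrow> query_phase A R y c d \<Longrightarrow> reachable_phase A x d {}"
| return: "(rstep A)\<^sup>*\<^sup>* (init_conf A x) c \<Longrightarrow> all_nonempty A c \<Longrightarrow> R \<subseteq> pairs A \<Longrightarrow>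
    return_phase A R y c d \<Longrightarrow> reachable_phase A x d (senders R)"

lemma tracks_bits:
  assumes "tracks A s g m ms y c d"
    and "\<And>i. i \<in> {1..deg A} \<Longrightarrow> snd (s i (cstate c i)) \<longleftrightarrow> i \<in> S" "snd m \<longleftrightarrow> Suc (deg A) \<in> S"
  shows "\<forall>i\<in>{1..Suc (deg A)}. snd (cstate d i) \<longleftrightarrow> i \<in> S"
  using assms(2,3) unfolding all_indices
  by (simp add: tracks_worker[OF assms(1)] tracks_master[OF assms(1)])

lemma rstep_all_nonempty: "rstep A c d \<Longrightarrow> all_nonempty A c"
  unfolding rstep_def ord_step_def comm_step_def ordinary_conf_def comm_conf_def by blast

lemma start_phase_init: "start_phase A (\<lambda>i. False) x (init_conf A x) (init_conf (coordinated A) x)"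
  unfolding tracks_def init_conf_def cstate_def cinput_def cstack_def by (simp add: bcomp_def)

text \<open>The bits agree with \<open>S\<close> because each set \<open>S\<close> is consumed by
  the very next ordinary step: \<open>sent\<close> follows the delivery of the announcement,
  \<open>return\<close> follows the simulated communication, and the other ordinary transitions
  clear all bits while \<open>S\<close> is empty.\<close>

lemma reachable_phase_step:
  assumes wf: "wf_pcpa A" and "reachable_phase A x d S" and st: "rstep (coordinated A) d d'"
  shows "if ordinary_conf (coordinated A) d
    then reachable_phase A x d' {} \<and> (\<forall>i\<in>{1..Suc (deg A)}. snd (cstate d' i) \<longleftrightarrow> i \<in> S)
    else reachable_phase A x d' (S \<union> {j. sends (coordinated A) d j})"
    (is "if ?o then ?P else ?Q")
  using assms(2)
proof cases
  case (start c b y)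
  \<comment> \<open>The start phase does not record nonempty stacks, since a run may accept with an
    emptied stack; here nonemptiness follows from the fact that \<open>d\<close> makes a
    step.\<close>
  have ne: "all_nonempty A c"
    using rstep_all_nonempty[OF st] tracks_all_nonempty[OF start(3)] unfolding all_nonempty_def
    by simp
  have o: ?o using start_phase_ordinary[OF start(3) ne] .
  then have s: "ord_step (coordinated A) d d'" using st rstep_ordinary by blast
  obtain R where R: "R \<subseteq> pairs A" "R = {} \<or> senders R \<noteq> {}" and t: "asking_phase A R y c d'"
    using start_phase_step[OF start(3) s ne] by blast
  have "reachable_phase A x d' {}" using start(2) ne R t by (rule reachable_phase.asking)
  moreover have "\<forall>i\<in>{1..Suc (deg A)}. snd (cstate d' i) \<longleftrightarrow> i \<in> S"
    by (rule tracks_bits[OF t]) (simp_all add: start(1))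
  ultimately show ?thesis using o by simp
next
  case (asking c R y)
  note c = asking_phase_comm[OF wf asking(6)]
  have no: "\<not> ?o" using not_ordinary_comm[OF c(1)] .
  have d': "d' = comm_succ (coordinated A) d"
    using st rstep_comm[OF c(1)] comm_step_iff[OF wf_coordinated[OF wf]] by blast
  have "reachable_phase A x d' {Suc (deg A)}"
    unfolding d' using asking(2-5) c(2) by (rule reachable_phase.told)
  moreover have "S \<union> {j. sends (coordinated A) d j} = {Suc (deg A)}" using c(3) asking(1) by simp
  ultimately show ?thesis using no by simp
next
  case (told c R y)
  have o: ?o using told_phase_ordinary[OF told(6)] .
  then have s: "ord_step (coordinated A) d d'" using st rstep_ordinary by blast
  have t: "act_phase A R y c d'" using told_phase_step[OF told(6) s] .
  have "reachable_phase A x d' {}" using told(2-5) t by (rule reachable_phase.act)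
  moreover have "\<forall>i\<in>{1..Suc (deg A)}. snd (cstate d' i) \<longleftrightarrow> i \<in> S"
    by (rule tracks_bits[OF t]) (simp_all add: told(1))
  ultimately show ?thesis using o by simp
next
  case (act c R y)
  have o: ?o using act_phase_ordinary[OF act(6,3)] .
  then have s: "ord_step (coordinated A) d d'" using st rstep_ordinary by blast
  show ?thesis
  proof (cases "R = {}")
    case True
    obtain c' y' where c': "ord_step A c c'" and t: "start_phase A (\<lambda>i. False) y' c' d'"
      using act_phase_quiet_step[OF act(6)[unfolded True] s act(3)] by blast
    have "rstep A c c'" using c' unfolding rstep_def by blast
    then have "(rstep A)\<^sup>*\<^sup>* (init_conf A x) c'" using act(2) by auto
    then have "reachable_phase A x d' {}" using t by (rule reachable_phase.start)
    moreover have "\<forall>i\<in>{1..Suc (deg A)}. snd (cstate d' i) \<longleftrightarrow> i \<in> S"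
      by (rule tracks_bits[OF t]) (simp_all add: act(1))
    ultimately show ?thesis using o by simp
  next
    case False
    then have t: "R = query_pairs A c" "query_phase A R y c d'" and R: "senders R \<noteq> {}"
      using act_phase_query_step[OF wf act(6) s act(3,4)] act(5) by blast+
    have "reachable_phase A x d' {}" using act(2,3) t(1) R t(2) by (rule reachable_phase.query)
    moreover have "\<forall>i\<in>{1..Suc (deg A)}. snd (cstate d' i) \<longleftrightarrow> i \<in> S"
      by (rule tracks_bits[OF t(2)]) (simp_all add: act(1))
    ultimately show ?thesis using o by simp
  qed
next
  case (query c R y)
  note c = query_phase_comm[OF wf query(3-6)]
  have no: "\<not> ?o" using not_ordinary_comm[OF c(3)] .
  have d': "d' = comm_succ (coordinated A) d"
    using st rstep_comm[OF c(3)] comm_step_iff[OF wf_coordinated[OF wf]] by blast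
  have "rstep A c (comm_succ A c)" using c(1) rstep_comm comm_step_iff[OF wf] by blast
  then have "(rstep A)\<^sup>*\<^sup>* (init_conf A x) (comm_succ A c)" using query(2) by auto
  moreover have "R \<subseteq> pairs A" using query_pairs_subset[OF wf] query(4) by blast
  ultimately have "reachable_phase A x d' (senders R)"
    unfolding d' using c(2,4) by (blast intro: reachable_phase.return)
  moreover have "S \<union> {j. sends (coordinated A) d j} = senders R" using c(5) query(1) by simp
  ultimately show ?thesis using no by simp
next
  case (return c R y)
  have o: ?o using return_phase_ordinary[OF return(5,3)] .
  then have s: "ord_step (coordinated A) d d'" using st rstep_ordinary by blast
  have t: "start_phase A (\<lambda>i. i \<in> senders R) y c d'"
    using return_phase_step[OF return(5) s return(3)] .
  have "reachable_phase A x d' {}" using return(2) t by (rule reachable_phase.start)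
  \<comment> \<open>The additional component has not sent since the last ordinary step, in
    accordance with the cleared bit of \<open>MStart\<close>.\<close>
  moreover have "Suc (deg A) \<notin> senders R" using return(4) unfolding senders_def pairs_def by auto
  then have "\<forall>i\<in>{1..Suc (deg A)}. snd (cstate d' i) \<longleftrightarrow> i \<in> S"
    by (intro tracks_bits[OF t]) (simp_all add: return(1))
  ultimately show ?thesis using o by simp
qed

lemma reachable_phase_init: "reachable_phase A x (init_conf (coordinated A) x) {}"
  using rtranclp.rtrancl_refl start_phase_init by (rule reachable_phase.start)

lemma comm_property_coordinated:
  assumes wf: "wf_pcpa A"
  shows "comm_property (coordinated A)"
proof -
  let ?B = "coordinated A"
  have "snd (cstate (cs (Suc k)) j) \<longleftrightarrow>
      (\<exists>l<k. sends ?B (cs l) j \<and> (\<forall>t. l \<le> t \<and> t < k \<longrightarrow> comm_conf ?B (cs t)))"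
    if init: "cs 0 = init_conf ?B x" and run: "\<forall>t<m. rstep ?B (cs t) (cs (Suc t))"
      and k: "k < m" "ordinary_conf ?B (cs k)" and j: "j \<in> {1..Suc (deg A)}" for x cs m k j
  proof -
    \<comment> \<open>The right-hand side of the communication property as a set; the induction
      shows that it is the set carried along by \<open>reachable_phase\<close>.\<close>
    define S where "S k = {j. \<exists>l<k. sends ?B (cs l) j \<and>
      (\<forall>t. l \<le> t \<and> t < k \<longrightarrow> comm_conf ?B (cs t))}" for k
    have "reachable_phase A x (cs k) (S k)" if "k \<le> m" for k
      using that
    proof (induction k)
      case 0
      then show ?case using reachable_phase_init init unfolding S_def by simp
    next
      case (Suc k)
      then have IH: "reachable_phase A x (cs k) (S k)" and st: "rstep ?B (cs k) (cs (Suc k))"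
        using run by auto
      show ?case
      proof (cases "ordinary_conf ?B (cs k)")
        case True
        then have "\<not> comm_conf ?B (cs k)" using not_ordinary_comm by blast
        \<comment> \<open>A witness \<open>l\<close> would require a communication configuration at
          every index from \<open>l\<close> to \<open>k\<close>, in particular at
          \<open>k\<close>.\<close>
        then have "S (Suc k) = {}" unfolding S_def using less_Suc_eq_le lessI by blast
        then show ?thesis using reachable_phase_step[OF wf IH st] True by simp
      next
        case False
        then have "comm_conf ?B (cs k)"
          using st unfolding rstep_def ord_step_def comm_step_def by blast
        then have "S (Suc k) = S k \<union> {j. sends ?B (cs k) j}"
          unfolding S_def by (auto simp: less_Suc_eq)
        then show ?thesis using reachable_phase_step[OF wf IH st] False by simp
      qed
    qed
    then have "reachable_phase A x (cs k) (S k)" using k(1) by simp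
    then have "snd (cstate (cs (Suc k)) j) \<longleftrightarrow> j \<in> S k"
      using reachable_phase_step[OF wf] run k j by auto
    then show ?thesis unfolding S_def by simp
  qed
  moreover have "\<exists>Q. pstates (bcomp A i) = Q \<times> UNIV \<and> \<not> snd (pinit (bcomp A i))" for i
    unfolding bcomp_def by auto
  ultimately show ?thesis unfolding comm_property_def coordinated_sel by blast
qed

lemma lang_coordinated_subset:
  assumes wf: "wf_pcpa A"
  shows "lang_r (coordinated A) \<subseteq> lang_r A"
proof
  fix x assume "x \<in> lang_r (coordinated A)"
  then obtain d where x: "set x \<subseteq> alph A"
    and r: "(rstep (coordinated A))\<^sup>*\<^sup>* (init_conf (coordinated A) x) d"
    and fin: "\<forall>i\<in>{1..Suc (deg A)}. cinput d i = [] \<and> cstate d i \<in> pfinal (bcomp A i)"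
    unfolding lang_r_def by auto
  from r have "\<exists>S. reachable_phase A x d S"
  proof induction
    case base
    show ?case using reachable_phase_init by blast
  next
    case (step d d')
    then obtain S where "reachable_phase A x d S" by blast
    from reachable_phase_step[OF wf this step(2)] show ?case by (auto split: if_splits)
  qed
  then obtain S where "reachable_phase A x d S" by blast
  \<comment> \<open>\<open>MStart\<close> occurs in the start phase only, so an accepting
    configuration encodes a reachable configuration of \<open>A\<close> with the same states and
    unread inputs.\<close>
  moreover have "fst (cstate d (Suc (deg A))) = MStart"
    using bspec[OF fin, of "Suc (deg A)"] unfolding bcomp_def by auto
  ultimately obtain c b y where c: "(rstep A)\<^sup>*\<^sup>* (init_conf A x) c" and t: "start_phase A b y c d"
    by cases (auto dest: tracks_master(1))
  have "cinput c i = [] \<and> cstate c i \<in> pfinal (comp A i)" if i: "i \<in> {1..deg A}" for i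
    using bspec[OF fin, of i] i by (auto simp: tracks_worker[OF t i] bcomp_def)
  then show "x \<in> lang_r A" using x c unfolding lang_r_def by blast
qed


section \<open>Simulating a step of the original system\<close>

text \<open>\<open>R\<close> may still be a wrong guess here, because the announcement is checked
  only on leaving \<open>Act\<close>. The three steps are announcing and asking, delivery, and
  moving \<open>R\<close> from the stack into the state.\<close>

lemma act_phase_reachable:
  assumes wf: "wf_pcpa A" and c: "well_formed_conf A c" "all_nonempty A c"
    and R: "R \<subseteq> pairs A" "R = {} \<or> senders R \<noteq> {}" and t: "start_phase A b y c d"
  shows "\<exists>d'. (rstep (coordinated A))\<^sup>*\<^sup>* d d' \<and> act_phase A R y c d'"
proof -
  let ?B = "coordinated A"
  have q: "cstate c i \<in> pstates (comp A i)" "hd (cstack c i) \<in> stalph A" "cstack c i \<noteq> []"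
    if "i \<in> {1..deg A}" for i
    using c that well_formed_hd[OF c that] unfolding well_formed_conf_def all_nonempty_def by auto
  have "\<exists>d1. ord_step ?B d d1 \<and> asking_phase A R y c d1"
  proof (rule tracks_ord_stepI[OF t start_phase_ordinary[OF t c(2)]])
    fix i assume i: "i \<in> {1..deg A}"
    have "btrans A i (Start (cstate c i), b i) None (hd (map Old (cstack c i)))
        (Wait (cstate c i), False) [Ask (Suc (deg A)), Old (hd (cstack c i))]"
      using ask_vec[OF i q(1,2)[OF i]] q(3)[OF i] by (simp add: list.map_sel(1))
    moreover have "Ask (Suc (deg A)) # map Old (cstack c i) =
        [Ask (Suc (deg A)), Old (hd (cstack c i))] @ tl (map Old (cstack c i))"
      using q(3)[OF i] by (cases "cstack c i") auto
    ultimately show "\<exists>a \<beta>. reads a (cinput c i) (cinput c i) \<and>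
        btrans A i (Start (cstate c i), b i) a (hd (map Old (cstack c i)))
          (Wait (cstate c i), False) \<beta> \<and>
        Ask (Suc (deg A)) # map Old (cstack c i) = \<beta> @ tl (map Old (cstack c i))"
      by (intro exI[of _ None] exI[of _ "[Ask (Suc (deg A)), Old (hd (cstack c i))]"]) simp
  next
    show "btrans A (Suc (deg A)) (MStart, False) None (hd [Bot]) (MWait R, False) [Vec R]"
      using guess[OF refl R] by simp
  qed simp_all
  then obtain d1 where d1: "ord_step ?B d d1" "asking_phase A R y c d1" by blast
  let ?d2 = "comm_succ ?B d1"
  note c2 = asking_phase_comm(1,2)[OF wf d1(2)]
  have d2: "comm_step ?B d1 ?d2" using c2(1) comm_step_iff[OF wf_coordinated[OF wf]] by blast
  have "\<exists>d3. ord_step ?B ?d2 d3 \<and> act_phase A R y c d3"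
  proof (rule tracks_ord_stepI[OF c2(2) told_phase_ordinary[OF c2(2)]])
    fix i assume i: "i \<in> {1..deg A}"
    have "btrans A i (Wait (cstate c i), False) None (hd (Vec R # map Old (cstack c i)))
        (Act R (cstate c i), False) []"
      using read_vec[OF i q(1)[OF i] R(1)] by simp
    then show "\<exists>a \<beta>. reads a (cinput c i) (cinput c i) \<and>
        btrans A i (Wait (cstate c i), False) a (hd (Vec R # map Old (cstack c i)))
          (Act R (cstate c i), False) \<beta> \<and>
        map Old (cstack c i) = \<beta> @ tl (Vec R # map Old (cstack c i))"
      by (intro exI[of _ None] exI[of _ "[]"]) simp
  next
    show "btrans A (Suc (deg A)) (MWait R, False) None (hd [Bot]) (MAct R, True) [Bot]"
      using sent[OF refl R(1)] by simp
  qed simp_all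
  then obtain d3 where d3: "ord_step ?B ?d2 d3" "act_phase A R y c d3" by blast
  have "rstep ?B d d1" "rstep ?B d1 ?d2" "rstep ?B ?d2 d3"
    using d1(1) d2 d3(1) unfolding rstep_def by blast+
  then have "(rstep ?B)\<^sup>*\<^sup>* d d3" by (meson r_into_rtranclp rtranclp_trans)
  then show ?thesis using d3(2) by blast
qed

text \<open>The additional component reads exactly what component 1 reads, so both exhaust the input
  together; \<open>quiet\<close> allows every letter of the alphabet.\<close>

lemma simulate_ord_step:
  assumes wf: "wf_pcpa A" and c: "well_formed_conf A c" and st: "ord_step A c c'"
    and t: "start_phase A b (cinput c 1) c d"
  shows "\<exists>d'. (rstep (coordinated A))\<^sup>*\<^sup>* d d' \<and> start_phase A (\<lambda>i. False) (cinput c' 1) c' d'"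
proof -
  let ?B = "coordinated A"
  have o: "all_nonempty A c" "query_pairs A c = {}"
    using st unfolding ord_step_def ordinary_conf_iff by blast+
  obtain d1 where d1: "(rstep ?B)\<^sup>*\<^sup>* d d1" "act_phase A {} (cinput c 1) c d1"
    using act_phase_reachable[OF wf c o(1) _ _ t, of "{}"] by blast
  have step: "\<exists>a \<beta>. reads a (cinput c i) (cinput c' i) \<and>
      (cstate c' i, \<beta>) \<in> ptrans (comp A i) (cstate c i) a (hd (cstack c i)) \<and>
      cstack c' i = \<beta> @ tl (cstack c i)" if i: "i \<in> {1..deg A}" for i
  proof -
    obtain a y p \<beta> where r: "reads a (cinput c i) y"
      and p: "(p, \<beta>) \<in> ptrans (comp A i) (cstate c i) a (hd (cstack c i))"
      and c': "c' i = (p, y, \<beta> @ tl (cstack c i))"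
      using st i unfolding ord_step_def reads_def by blast
    have "cstate c' i = p" "cinput c' i = y" "cstack c' i = \<beta> @ tl (cstack c i)"
      unfolding cstate_def cinput_def cstack_def c' by simp_all
    then show ?thesis using r p by blast
  qed
  have 1: "1 \<in> {1..deg A}" using wf_pcpaD(1)[OF wf] by simp
  then obtain a1 \<beta>1 where a1: "reads a1 (cinput c 1) (cinput c' 1)"
    "(cstate c' 1, \<beta>1) \<in> ptrans (comp A 1) (cstate c 1) a1 (hd (cstack c 1))"
    using step by blast
  have "\<exists>d'. ord_step ?B d1 d' \<and> start_phase A (\<lambda>i. False) (cinput c' 1) c' d'"
  proof (rule tracks_ord_stepI[OF d1(2) act_phase_ordinary[OF d1(2) o(1)]])
    fix i assume i: "i \<in> {1..deg A}"
    obtain a \<beta> where a: "reads a (cinput c i) (cinput c' i)"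
      "(cstate c' i, \<beta>) \<in> ptrans (comp A i) (cstate c i) a (hd (cstack c i))"
      "cstack c' i = \<beta> @ tl (cstack c i)" using step[OF i] by blast
    have "{j \<in> qidx A. qsym A j = hd (cstack c i)} = {}"
      using query_pairs_Image[OF i, of c] o(2) by simp
    then have "btrans A i (Act {} (cstate c i), False) a (Old (hd (cstack c i)))
        (Start (cstate c' i), False) (map Old \<beta>)"
      by (rule original[OF i a(2)])
    moreover have "cstack c i \<noteq> []" using o(1) i unfolding all_nonempty_def by blast
    ultimately show "\<exists>a \<beta>. reads a (cinput c i) (cinput c' i) \<and>
        btrans A i (Act {} (cstate c i), False) a (hd (map Old (cstack c i)))
          (Start (cstate c' i), False) \<beta> \<and>
        map Old (cstack c' i) = \<beta> @ tl (map Old (cstack c i))"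
      using a(1,3) by (intro exI[of _ a] exI[of _ "map Old \<beta>"]) (simp add: list.map_sel(1) map_tl)
  next
    show "reads a1 (cinput c 1) (cinput c' 1)" using a1(1) .
    show "btrans A (Suc (deg A)) (MAct {}, True) a1 (hd [Bot]) (MStart, False) [Bot]"
      using quiet[OF refl wf_ptransD(5)[OF wf 1 a1(2)]] by simp
  qed simp
  then obtain d' where "rstep ?B d1 d'" "start_phase A (\<lambda>i. False) (cinput c' 1) c' d'"
    unfolding rstep_def by blast
  then show ?thesis using d1(1) by (meson rtranclp.rtrancl_into_rtrancl)
qed

text \<open>The bits \<open>b'\<close> record who has sent. Any value will do for continuing the
  simulation, because \<open>ask_vec\<close> ignores and clears the bit.\<close>

lemma simulate_comm_step:
  assumes wf: "wf_pcpa A" and c: "well_formed_conf A c" and st: "comm_step A c c'"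
    and t: "start_phase A b y c d"
  shows "\<exists>d' b'. (rstep (coordinated A))\<^sup>*\<^sup>* d d' \<and> start_phase A b' y c' d'"
proof (cases "senders (query_pairs A c) = {}")
  case True \<comment> \<open>a circular query: the step does not change the configuration\<close>
  have c': "c' = comm_succ A c" using st comm_step_iff[OF wf] by blast
  have no: "\<not> answers A c i j" if "i \<in> {1..deg A}" for i j
    using answers_iff_senders[OF wf that] True by simp
  have "c' i = (cstate c i, cinput c i, cstack c i)" if i: "i \<in> {1..deg A}" for i
    unfolding c' using no i by (intro comm_succ_unchanged[OF i]) simp_all
  then have "start_phase A b y c' d"
    using t unfolding tracks_def cstate_def[of c'] cinput_def[of c'] cstack_def[of c'] by simp
  then show ?thesis by blast
next
  case False
  let ?B = "coordinated A" and ?R = "query_pairs A c"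
  have c': "c' = comm_succ A c" and ne: "all_nonempty A c"
    using st comm_step_iff[OF wf] unfolding comm_conf_def by blast+
  have q: "cstate c i \<in> pstates (comp A i)" "hd (cstack c i) \<in> stalph A" "cstack c i \<noteq> []"
    if "i \<in> {1..deg A}" for i
    using c ne that well_formed_hd[OF c ne that] unfolding well_formed_conf_def all_nonempty_def
    by auto
  have R: "?R \<subseteq> pairs A" "?R \<noteq> {}"
    using query_pairs_subset[OF wf] False unfolding senders_def by auto
  obtain d1 where d1: "(rstep ?B)\<^sup>*\<^sup>* d d1" "act_phase A ?R y c d1"
    using act_phase_reachable[OF wf c ne R(1) _ t] False by blast
  have "\<exists>d2. ord_step ?B d1 d2 \<and> query_phase A ?R y c d2"
  proof (rule tracks_ord_stepI[OF d1(2) act_phase_ordinary[OF d1(2) ne]])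
    fix i assume i: "i \<in> {1..deg A}"
    have hd: "hd (map Old (cstack c i)) = Old (hd (cstack c i))"
      using q(3)[OF i] by (simp add: list.map_sel(1))
    note I = query_pairs_Image[OF i, of c]
    show "\<exists>a \<beta>. reads a (cinput c i) (cinput c i) \<and>
        btrans A i (Act ?R (cstate c i), False) a (hd (map Old (cstack c i)))
          (Back ?R (cstate c i), False) \<beta> \<and>
        ask_stack ?R i (cstack c i) = \<beta> @ tl (map Old (cstack c i))"
    proof (cases "?R `` {i} \<inter> senders ?R = {}")
      case True
      have "map Old (cstack c i) = [Old (hd (cstack c i))] @ tl (map Old (cstack c i))"
        using q(3)[OF i] by (cases "cstack c i") auto
      then show ?thesis
        using btrans.keep[OF i q(1,2)[OF i] R(1) I True R(2), of False] ask_stack_keep[OF True] hd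
        by (intro exI[of _ None] exI[of _ "[Old (hd (cstack c i))]"]) simp
    next
      case False
      then obtain j where j: "(i, j) \<in> ?R" "j \<in> senders ?R" by blast
      show ?thesis
        using btrans.ask[OF i q(1,2)[OF i] R(1) I j, of False] ask_stack_ask[OF wf j, of "cstack c i"] hd
        by (intro exI[of _ None] exI[of _ "[Ask j]"]) (simp add: map_tl)
    qed
  next
    show "btrans A (Suc (deg A)) (MAct ?R, True) None (hd [Bot]) (MBack, False) [Bot]"
      using noisy[OF refl R] by simp
  qed simp_all
  then obtain d2 where d2: "ord_step ?B d1 d2" "query_phase A ?R y c d2" by blast
  let ?d3 = "comm_succ ?B d2"
  note c3 = query_phase_comm(2-4)[OF wf ne refl False d2(2), folded c']
  have d3: "comm_step ?B d2 ?d3" using c3(2) comm_step_iff[OF wf_coordinated[OF wf]] by blast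
  have cw: "well_formed_conf A c'" using well_formed_comm_step[OF wf c st] .
  have q': "cstate c' i \<in> pstates (comp A i)" "hd (cstack c' i) \<in> stalph A" "cstack c' i \<noteq> []"
    if "i \<in> {1..deg A}" for i
    using cw c3(1) that well_formed_hd[OF cw c3(1) that]
    unfolding well_formed_conf_def all_nonempty_def by auto
  have "\<exists>d4. ord_step ?B ?d3 d4 \<and> start_phase A (\<lambda>i. i \<in> senders ?R) y c' d4"
  proof (rule tracks_ord_stepI[OF c3(3) return_phase_ordinary[OF c3(3) c3(1)]])
    fix i assume i: "i \<in> {1..deg A}"
    have hd: "hd (map Old (cstack c' i)) = Old (hd (cstack c' i))"
      and tl: "map Old (cstack c' i) = [Old (hd (cstack c' i))] @ tl (map Old (cstack c' i))"
      using q'(3)[OF i] by (cases "cstack c' i"; simp)+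
    show "\<exists>a \<beta>. reads a (cinput c' i) (cinput c' i) \<and>
        btrans A i (Back ?R (cstate c' i), False) a (hd (map Old (cstack c' i)))
          (Start (cstate c' i), i \<in> senders ?R) \<beta> \<and>
        map Old (cstack c' i) = \<beta> @ tl (map Old (cstack c' i))"
      using btrans.return[OF i q'(1,2)[OF i] R(1), of False] tl hd
      by (intro exI[of _ None] exI[of _ "[Old (hd (cstack c' i))]"]) simp
  next
    show "btrans A (Suc (deg A)) (MBack, False) None (hd [Bot]) (MStart, False) [Bot]"
      using mback[OF refl] by simp
  qed simp_all
  then obtain d4 where d4: "ord_step ?B ?d3 d4" "start_phase A (\<lambda>i. i \<in> senders ?R) y c' d4"
    by blast
  have "rstep ?B d1 d2" "rstep ?B d2 ?d3" "rstep ?B ?d3 d4"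
    using d2(1) d3 d4(1) unfolding rstep_def by blast+
  then have "(rstep ?B)\<^sup>*\<^sup>* d d4" using d1(1) by (meson rtranclp.rtrancl_into_rtrancl)
  then show ?thesis using d4(2) by (intro exI conjI)
qed

lemma comm_step_input:
  "comm_step A c c' \<Longrightarrow> i \<in> {1..deg A} \<Longrightarrow> cinput c' i = cinput c i"
  unfolding comm_step_def by blast

lemma lang_subset_coordinated:
  assumes wf: "wf_pcpa A"
  shows "lang_r A \<subseteq> lang_r (coordinated A)"
proof
  fix x assume "x \<in> lang_r A"
  then obtain c where x: "set x \<subseteq> alph A" and r: "(rstep A)\<^sup>*\<^sup>* (init_conf A x) c"
    and fin: "\<forall>i\<in>{1..deg A}. cinput c i = [] \<and> cstate c i \<in> pfinal (comp A i)"
    unfolding lang_r_def by auto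
  have 1: "1 \<in> {1..deg A}" using wf_pcpaD(1)[OF wf] by simp
  from r have "\<exists>d b. (rstep (coordinated A))\<^sup>*\<^sup>* (init_conf (coordinated A) x) d \<and>
      start_phase A b (cinput c 1) c d"
  proof induction
    case base
    have "cinput (init_conf A x) 1 = x" unfolding init_conf_def cinput_def by simp
    then show ?case using start_phase_init[of A x] by force
  next
    case (step c c')
    then obtain d b where d: "(rstep (coordinated A))\<^sup>*\<^sup>* (init_conf (coordinated A) x) d"
      and t: "start_phase A b (cinput c 1) c d" by blast
    have c: "well_formed_conf A c" using well_formed_reachable[OF wf step(1)] .
    have "\<exists>d' b'. (rstep (coordinated A))\<^sup>*\<^sup>* d d' \<and> start_phase A b' (cinput c' 1) c' d'"
    proof (cases "ord_step A c c'")
      case True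
      then obtain d' where "(rstep (coordinated A))\<^sup>*\<^sup>* d d'"
        "start_phase A (\<lambda>i. False) (cinput c' 1) c' d'"
        using simulate_ord_step[OF wf c True t] by blast
      then show ?thesis by (intro exI[of _ d'] exI[of _ "\<lambda>i. False"]) simp
    next
      case False
      then have s: "comm_step A c c'" using step(2) unfolding rstep_def by blast
      show ?thesis using simulate_comm_step[OF wf c s t] unfolding comm_step_input[OF s 1] .
    qed
    then show ?case using d by (meson rtranclp_trans)
  qed
  then obtain d b where d: "(rstep (coordinated A))\<^sup>*\<^sup>* (init_conf (coordinated A) x) d"
    and t: "start_phase A b (cinput c 1) c d" by blast
  have "cinput d i = [] \<and> cstate d i \<in> pfinal (bcomp A i)" if i: "i \<in> {1..deg A}" for i
    using bspec[OF fin i] i by (simp add: tracks_worker[OF t i] bcomp_def)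
  moreover have "cinput d (Suc (deg A)) = [] \<and> cstate d (Suc (deg A)) \<in> pfinal (bcomp A (Suc (deg A)))"
    using bspec[OF fin 1] by (simp add: tracks_master[OF t] bcomp_def)
  ultimately have "\<forall>i\<in>{1..Suc (deg A)}. cinput d i = [] \<and> cstate d i \<in> pfinal (bcomp A i)"
    unfolding all_indices by blast
  then show "x \<in> lang_r (coordinated A)" using x d unfolding lang_r_def by auto
qed


section \<open>Renaming states and stack symbols\<close>

text \<open>Transitions are looked up through \<open>f'\<close> and \<open>h'\<close>, which may
  take arbitrary values outside the images of \<open>f\<close> and \<open>h\<close>; the two tests
  prevent such arguments from inheriting transitions.\<close>

definition rename ::
  "('q \<Rightarrow> 'r) \<Rightarrow> ('g \<Rightarrow> 'h) \<Rightarrow> ('r \<Rightarrow> 'q) \<Rightarrow> ('h \<Rightarrow> 'g) \<Rightarrow> ('q, 'a, 'g) pcpa \<Rightarrow> ('r, 'a, 'h) pcpa" where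
  "rename f h f' h' A = \<lparr>deg = deg A, alph = alph A, stalph = h ` stalph A,
     comp = (\<lambda>i. \<lparr>pstates = f ` pstates (comp A i),
       ptrans = (\<lambda>q a X. if f (f' q) = q \<and> h (h' X) = X
         then (\<lambda>(p, \<beta>). (f p, map h \<beta>)) ` ptrans (comp A i) (f' q) a (h' X) else {}),
       pinit = f (pinit (comp A i)), pbottom = h (pbottom (comp A i)),
       pfinal = f ` pfinal (comp A i)\<rparr>),
     qsym = (\<lambda>j. h (qsym A j)), qidx = qidx A\<rparr>"

context
  fixes f h f' h' and A :: "('q, 'a, 'g) pcpa" and Q
  assumes wf: "wf_pcpa A"
    and f': "\<And>q. q \<in> Q \<Longrightarrow> f' (f q) = q" and h': "\<And>X. X \<in> stalph A \<Longrightarrow> h' (h X) = X"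
    and Q: "\<And>i. i \<in> {1..deg A} \<Longrightarrow> pstates (comp A i) \<subseteq> Q"
      "\<And>i. pinit (comp A i) \<in> Q" "\<And>i. pbottom (comp A i) \<in> stalph A"
begin

lemma wf_rename: "wf_pcpa (rename f h f' h' A)"
proof -
  have inj: "inj_on h (stalph A)" using h' by (rule inj_on_inverseI)
  have "inj_on (\<lambda>j. h (qsym A j)) {1..deg A}"
  proof (rule inj_onI)
    fix i j assume *: "i \<in> {1..deg A}" "j \<in> {1..deg A}" "h (qsym A i) = h (qsym A j)"
    then have "qsym A i = qsym A j" using inj wf_pcpaD(6)[OF wf] by (meson inj_onD)
    then show "i = j" using wf_pcpaD(5)[OF wf] * by (meson inj_onD)
  qed
  moreover have "finite (ptrans (comp (rename f h f' h' A) i) q a X) \<and>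
      ptrans (comp (rename f h f' h' A) i) q a X \<subseteq> f ` pstates (comp A i) \<times> lists (h ` stalph A) \<and>
      (q \<notin> f ` pstates (comp A i) \<or> X \<notin> h ` stalph A \<or> (\<exists>b. a = Some b \<and> b \<notin> alph A) \<longrightarrow>
        ptrans (comp (rename f h f' h' A) i) q a X = {})" if i: "i \<in> {1..deg A}" for i q a X
  proof (intro conjI impI)
    show "finite (ptrans (comp (rename f h f' h' A) i) q a X)"
      using wf_pcpaD(11)[OF wf i] unfolding rename_def by simp
    have *: "\<exists>p' \<beta>'. p = f p' \<and> \<beta> = map h \<beta>' \<and> (p', \<beta>') \<in> ptrans (comp A i) (f' q) a (h' X) \<and>
      f (f' q) = q \<and> h (h' X) = X" if "(p, \<beta>) \<in> ptrans (comp (rename f h f' h' A) i) q a X" for p \<beta>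
      using that unfolding rename_def by (auto split: if_splits)
    show "ptrans (comp (rename f h f' h' A) i) q a X \<subseteq>
      f ` pstates (comp A i) \<times> lists (h ` stalph A)"
    proof (rule subrelI)
      fix p \<beta> assume "(p, \<beta>) \<in> ptrans (comp (rename f h f' h' A) i) q a X"
      then obtain p' \<beta>' where "p = f p'" "\<beta> = map h \<beta>'"
        and t: "(p', \<beta>') \<in> ptrans (comp A i) (f' q) a (h' X)" using * by blast
      then show "(p, \<beta>) \<in> f ` pstates (comp A i) \<times> lists (h ` stalph A)"
        using wf_ptransD(3,4)[OF wf i t] by (auto simp: in_lists_conv_set)
    qed
    assume out: "q \<notin> f ` pstates (comp A i) \<or> X \<notin> h ` stalph A \<or> (\<exists>b. a = Some b \<and> b \<notin> alph A)"
    show "ptrans (comp (rename f h f' h' A) i) q a X = {}"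
    proof (rule ccontr)
      assume "ptrans (comp (rename f h f' h' A) i) q a X \<noteq> {}"
      then obtain p \<beta> where "(p, \<beta>) \<in> ptrans (comp (rename f h f' h' A) i) q a X" by auto
      then obtain p' \<beta>' where t: "(p', \<beta>') \<in> ptrans (comp A i) (f' q) a (h' X)"
        and "f (f' q) = q" "h (h' X) = X" using * by blast
      then show False using out wf_ptransD(1,2,5)[OF wf i t] by force
    qed
  qed
  moreover have "(\<lambda>j. h (qsym A j)) ` {1..deg A} \<subseteq> h ` stalph A" using wf_pcpaD(6)[OF wf] by blast
  ultimately show ?thesis
    using wf_pcpaD(1-4,7-10)[OF wf] unfolding wf_pcpa_def by (simp add: rename_def image_mono)
qed

lemma renaming_rename: "renaming f h A (rename f h f' h' A)"
proof -
  have "inj_on h (stalph A)" using h' by (rule inj_on_inverseI)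
  moreover have "(f p, map h \<beta>) \<in> ptrans (comp (rename f h f' h' A) i) (f q) a (h X)"
    if i: "i \<in> {1..deg A}" and t: "(p, \<beta>) \<in> ptrans (comp A i) q a X" for i p \<beta> q a X
  proof -
    have "f' (f q) = q" "h' (h X) = X" using wf_ptransD(1,2)[OF wf i t] Q(1)[OF i] f' h' by blast+
    then show ?thesis using t unfolding rename_def by force
  qed
  ultimately show ?thesis unfolding renaming_def by (simp add: rename_def)
qed

text \<open>One-sided inverses suffice: sources are looked up through \<open>f'\<close> and
  \<open>h'\<close> by construction, and targets are images under \<open>f\<close> and
  \<open>h\<close>, which \<open>f'\<close> and \<open>h'\<close> undo.\<close>

lemma renaming_rename_inverse: "renaming f' h' (rename f h f' h' A) A"
proof -
  have "inj_on h' (h ` stalph A)" using h' by (intro inj_on_inverseI[of _ h]) auto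
  moreover have "(f' p, map h' \<beta>) \<in> ptrans (comp A i) (f' q) a (h' X)"
    if i: "i \<in> {1..deg A}" and t: "(p, \<beta>) \<in> ptrans (comp (rename f h f' h' A) i) q a X"
    for i p \<beta> q a X
  proof -
    obtain p' \<beta>' where p: "p = f p'" "\<beta> = map h \<beta>'"
      and t': "(p', \<beta>') \<in> ptrans (comp A i) (f' q) a (h' X)"
      using t unfolding rename_def by (auto split: if_splits)
    have "f' p = p'" using p(1) wf_ptransD(3)[OF wf i t'] Q(1)[OF i] f' by blast
    moreover have "map h' \<beta> = \<beta>'"
      using wf_ptransD(4)[OF wf i t'] h' unfolding p(2) by (simp add: map_idI subset_iff)
    ultimately show ?thesis using t' by simp
  qed
  moreover have "f' (f q) \<in> pfinal (comp A i)" if "i \<in> {1..deg A}" "q \<in> pfinal (comp A i)" for i q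
    using that f' Q(1) wf_pcpaD(10)[OF wf] by (metis subset_iff)
  moreover have "h' (h (qsym A j)) = qsym A j" if "j \<in> {1..deg A}" for j
    using wf_pcpaD(6)[OF wf that] h' by blast
  ultimately show ?thesis
    using f'[OF Q(2)] h'[OF Q(3)] unfolding renaming_def by (simp add: rename_def)
qed

end

section \<open>Transfer of the communication property and the final renaming\<close>

text \<open>The property is pulled back against the renaming: runs of \<open>A\<close> become runs
  of \<open>B\<close>, and on well-formed configurations \<open>sends\<close> and the kind of
  configuration are both preserved and reflected. The form \<open>map_prod e id\<close> leaves the
  bits untouched. The product form of the state sets cannot be pulled back and is assumed.\<close>

lemma renaming_comm_property:
  assumes ren: "renaming (map_prod e id) h A B" and wf: "wf_pcpa A" "wf_pcpa B"
    and B: "comm_property B" and st: "\<forall>i\<in>{1..deg A}. \<exists>Q. pstates (comp A i) = Q \<times> UNIV"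
  shows "comm_property A"
proof -
  let ?m = "map_conf (map_prod e id) h"
  have deg: "deg B = deg A" and al: "alph B = alph A" using ren unfolding renaming_def by blast+
  have bit: "snd (cstate (?m c) j) = snd (cstate c j)" for c j
    by (simp add: snd_map_prod)
  have sends: "sends B (?m c) j \<longleftrightarrow> sends A c j" if c: "well_formed_conf A c" for c j
  proof (cases "comm_conf A c")
    case True
    then have ne: "all_nonempty A c" unfolding comm_conf_def by blast
    have "(\<exists>i\<in>{1..deg A}. answers B (?m c) i j \<and> \<not> snd (cstate c i) \<and> \<not> snd (cstate c j)) \<longleftrightarrow>
        (\<exists>i\<in>{1..deg A}. answers A c i j \<and> \<not> snd (cstate c i) \<and> \<not> snd (cstate c j))"
      by (rule bex_cong[OF refl]) (simp only: renaming_answers[OF ren wf c ne])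
    then show ?thesis
      unfolding sends_def bit deg renaming_comm[OF ren wf c] by simp
  next
    case False
    then show ?thesis unfolding sends_def renaming_comm[OF ren wf c] by simp
  qed
  have "\<not> snd (pinit (comp A j))" if "j \<in> {1..deg A}" for j
  proof -
    have "pinit (comp B j) = map_prod e id (pinit (comp A j))"
      using ren unfolding renaming_def by blast
    moreover have "\<not> snd (pinit (comp B j))" using B that deg unfolding comm_property_def by simp
    ultimately show ?thesis by (simp add: snd_map_prod)
  qed
  moreover have "snd (cstate (cs (Suc k)) j) \<longleftrightarrow>
      (\<exists>l<k. sends A (cs l) j \<and> (\<forall>t. l \<le> t \<and> t < k \<longrightarrow> comm_conf A (cs t)))"
    if x: "set x \<subseteq> alph A" and init: "cs 0 = init_conf A x"
      and run: "\<forall>t<m. rstep A (cs t) (cs (Suc t))"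
      and k: "k < m" "ordinary_conf A (cs k)" and j: "j \<in> {1..deg A}" for x cs m k j
  proof -
    have wfc: "well_formed_conf A (cs t)" if "t \<le> m" for t
      using that
    proof (induction t)
      case 0
      then show ?case using init well_formed_init[OF wf(1)] by simp
    next
      case (Suc t)
      then show ?case using run well_formed_rstep[OF wf(1)] by simp
    qed
    define ds where "ds t = ?m (cs t)" for t
    have "ds 0 = init_conf B x" unfolding ds_def init using renaming_init[OF ren wf] by simp
    moreover have "\<forall>t<m. rstep B (ds t) (ds (Suc t))"
      unfolding ds_def using run wfc renaming_rstep[OF ren wf] by simp
    moreover have "ordinary_conf B (ds k)"
      unfolding ds_def using k wfc renaming_ordinary[OF ren wf] by simp
    ultimately have "snd (cstate (ds (Suc k)) j) \<longleftrightarrow>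
      (\<exists>l<k. sends B (ds l) j \<and> (\<forall>t. l \<le> t \<and> t < k \<longrightarrow> comm_conf B (ds t)))"
      using B x k(1) j unfolding comm_property_def al deg by blast
    moreover have "sends B (ds l) j \<longleftrightarrow> sends A (cs l) j"
      "comm_conf B (ds l) \<longleftrightarrow> comm_conf A (cs l)" if "l < k" for l
      unfolding ds_def using that k(1) wfc sends renaming_comm[OF ren wf] by simp_all
    ultimately show ?thesis unfolding bit ds_def by (metis (no_types, lifting))
  qed
  ultimately show ?thesis using st unfolding comm_property_def by blast
qed

theorem theorem2:
  fixes A :: "('q, 'a, 'g) pcpa"
  assumes "wf_pcpa A"
  shows "\<exists>A' :: (nat \<times> bool, 'a, nat) pcpa.
           wf_pcpa A' \<and> alph A' = alph A \<and> comm_property A' \<and> lang_r A' = lang_r A"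
proof -
  let ?B = "coordinated A"
  have wfB: "wf_pcpa ?B" using wf_coordinated[OF assms] .
  \<comment> \<open>Only the first coordinates are numbered, so that the bit remains the second
    coordinate of the new states.\<close>
  define P where "P = (\<Union>i\<in>{1..Suc (deg A)}. fst ` pstates (bcomp A i))"
  have "finite P" using wf_pcpaD(7)[OF wfB] unfolding P_def by simp
  then obtain e :: "'q bstate \<Rightarrow> nat" where e: "inj_on e P"
    using finite_imp_inj_to_nat_seg by metis
  have "finite (bsyms A)" using wf_pcpaD(3)[OF wfB] by simp
  then obtain h :: "'g bsym \<Rightarrow> nat" where h: "inj_on h (bsyms A)"
    using finite_imp_inj_to_nat_seg by metis
  let ?f = "map_prod e id :: 'q bstate \<times> bool \<Rightarrow> nat \<times> bool"
  let ?f' = "map_prod (inv_into P e) id" and ?h' = "inv_into (bsyms A) h"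
  let ?C = "rename ?f h ?f' ?h' ?B"
  have f': "?f' (?f q) = q" if "q \<in> P \<times> UNIV" for q using that e by auto
  have h': "?h' (h X) = X" if "X \<in> stalph ?B" for X using that h by simp
  have Q1: "pstates (comp ?B i) \<subseteq> P \<times> UNIV" if "i \<in> {1..deg ?B}" for i
    using that unfolding P_def by force
  \<comment> \<open>\<open>init_conf\<close> also assigns initial states to indices outside the
    system; these are all \<open>MStart\<close>, which must therefore be among the numbered
    states.\<close>
  have "MStart \<in> fst ` pstates (bcomp A (Suc (deg A)))" unfolding bcomp_def by simp
  then have "MStart \<in> P" unfolding P_def by fastforce
  then have Q2: "pinit (comp ?B i) \<in> P \<times> UNIV" for i
    using Q1[of i] wf_pcpaD(8)[OF wfB, of i] by (cases "i \<in> {1..deg A}") (auto simp: bcomp_def)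
  have Q3: "pbottom (comp ?B i) \<in> stalph ?B" for i
    using wf_pcpaD(9)[OF assms, of i] by (auto simp: bcomp_def bsyms_def)
  have C: "wf_pcpa ?C" using wfB f' h' Q1 Q2 Q3 by (rule wf_rename)
  have ren: "renaming ?f h ?B ?C" "renaming ?f' ?h' ?C ?B"
    using renaming_rename[where f = ?f and f' = ?f' and h' = ?h', OF wfB f' h' Q1 Q2 Q3]
      renaming_rename_inverse[where f = ?f and f' = ?f' and h' = ?h', OF wfB f' h' Q1 Q2 Q3] by simp_all
  have "\<exists>Q. pstates (comp ?C i) = Q \<times> UNIV" for i
  proof -
    obtain Q where "pstates (bcomp A i) = Q \<times> UNIV" unfolding bcomp_def by simp
    then have "pstates (comp ?C i) = (e ` Q) \<times> UNIV" unfolding rename_def by force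
    then show ?thesis by blast
  qed
  then have "comm_property ?C"
    using renaming_comm_property[OF ren(2) C wfB comm_property_coordinated[OF assms]] by blast
  moreover have "lang_r ?C = lang_r A"
    using renaming_lang[OF ren(1) wfB C] renaming_lang[OF ren(2) C wfB]
      lang_coordinated_subset[OF assms] lang_subset_coordinated[OF assms] by blast
  moreover have "alph ?C = alph A" unfolding rename_def by simp
  ultimately show ?thesis using C by blast
qed

end
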